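(* For $i=1,2$ let $G_i$ be a connected $r_i$-regular graph with $p_i$ vertices and $q_i$ edges, where $G_1$ is triangle-free. Let $r_1,\lambda_2,\ldots,\lambda_{p_1}$ and $r_2,\beta_2,\ldots,\beta_{p_2}$ be the adjacency eigenvalues of $G_1$ and $G_2$ respectively. Then the eigenvalues of $\epsilon(C[G_1]\veebar G_2)$, counted with multiplicity, are: (1) $-2$ with multiplicity $q_1-p_1$; (2) $-2(1+\beta_j)$ for $j=2,\ldots,p_2$; (3) $(\lambda_i-1)\pm\sqrt{(\lambda_i+1)^2+4(\lambda_i+r_1)}$ for $i=2,\ldots,p_1$; (4) the three eigenvalues of the matrix $\begin{pmatrix}2r_1&2(q_1-r_1)&2p_2\\2(p_1-2)&2(q_1-1)&0\\2p_1&0&2(p_2-1-r_2)\end{pmatrix}$.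
   Context: All graphs are finite, simple, undirected and connected. For a connected graph $H$ with vertices $v_1,\ldots,v_n$, $d(v_i,v_j)$ is the distance and $e(v_i)=\max_j d(v_i,v_j)$ the eccentricity. The eccentricity matrix $\epsilon(H)$ has $(i,j)$ entry $d(v_i,v_j)$ if $d(v_i,v_j)=\min\{e(v_i),e(v_j)\}$ and $0$ otherwise. The central graph $C[G]$ has vertex set $V(G)\cup I(G)$, where $I(G)=\{w_e:e\in E(G)\}$; its edges are $uw_e$ for each edge $e$ and each endpoint $u$ of $e$, and $uv$ for all distinct $u,v\in V(G)$ nonadjacent in $G$ (original edges of $G$ are not kept). The central edge join $C[G_1]\veebar G_2$ is obtained from the disjoint union of $C[G_1]$ and $G_2$ by joining every vertex of $I(G_1)$ to every vertex of $G_2$.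
   Formalization: The condition p_1 ≤ q_1 is added, excluding only G_1 = K_1 and K_2; there the multiplicity q_1 − p_1 is −1 and the claim fails: for G_1 = K_2, G_2 = K_1 the spectrum is −2, −2, 2±√7, while the list gives −2, −2, 0, 4. *)

theory Defs
  imports
    "Graph_Theory.Graph_Theory"
    "Jordan_Normal_Form.Char_Poly"
    "HOL-Computational_Algebra.Fundamental_Theorem_Algebra"
begin

text \<open>
  A finite simple undirected graph is a \<open>pair_graph\<close>: each undirected edge is represented by its
  two opposite arcs.
\<close>

text \<open>Qualified, since \<open>connected\<close> is also the name of the topological notion.\<close>

abbreviation connected_graph :: "'a pair_pre_digraph \<Rightarrow> bool" where
  "connected_graph G \<equiv> pair_graph G \<and> Digraph_Component.connected (with_proj G)"

definition edge_set :: "'a pair_pre_digraph \<Rightarrow> 'a set set" where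
  "edge_set G = {{u, v} | u v. (u, v) \<in> parcs G}"

definition regular_graph :: "nat \<Rightarrow> 'a pair_pre_digraph \<Rightarrow> bool" where
  "regular_graph r G \<longleftrightarrow> (\<forall>v \<in> pverts G. out_degree (with_proj G) v = r)"

definition triangle_free :: "'a pair_pre_digraph \<Rightarrow> bool" where
  "triangle_free G \<longleftrightarrow> \<not> (\<exists>u v w. (u, v) \<in> parcs G \<and> (v, w) \<in> parcs G \<and> (w, u) \<in> parcs G)"

text \<open>
  The shortest-path function of the library with unit arc weights. It is finite between
  the vertices of a connected graph, so nothing is lost in the conversion to a real number there.
\<close>

definition gdist :: "'a pair_pre_digraph \<Rightarrow> 'a \<Rightarrow> 'a \<Rightarrow> real" where
  "gdist G u v = real_of_ereal (wf_digraph.\<mu> (with_proj G) (\<lambda>_. 1) u v)"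

definition eccentricity :: "'a pair_pre_digraph \<Rightarrow> 'a \<Rightarrow> real" where
  "eccentricity G u = Max (gdist G u ` pverts G)"

text \<open>Matrices of a graph are taken with respect to an enumeration \<open>vs\<close> of its vertices.\<close>

definition enumerates :: "'a list \<Rightarrow> 'a pair_pre_digraph \<Rightarrow> bool" where
  "enumerates vs G \<longleftrightarrow> distinct vs \<and> set vs = pverts G"

definition adjacency_matrix :: "'a pair_pre_digraph \<Rightarrow> 'a list \<Rightarrow> real mat" where
  "adjacency_matrix G vs = mat (length vs) (length vs)
     (\<lambda>(i, j). if (vs ! i, vs ! j) \<in> parcs G then 1 else 0)"

definition eccentricity_matrix :: "'a pair_pre_digraph \<Rightarrow> 'a list \<Rightarrow> real mat" where
  "eccentricity_matrix G vs = mat (length vs) (length vs)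
     (\<lambda>(i, j). if gdist G (vs ! i) (vs ! j)
                    = min (eccentricity G (vs ! i)) (eccentricity G (vs ! j))
               then gdist G (vs ! i) (vs ! j) else 0)"

text \<open>
  All complex eigenvalues of a real square matrix, with algebraic multiplicity
  (for symmetric matrices this is also the geometric multiplicity). Working over the complex
  numbers guarantees that an \<open>n \<times> n\<close> matrix has exactly \<open>n\<close> eigenvalues.
\<close>

definition eigenvalues :: "real mat \<Rightarrow> complex multiset" where
  "eigenvalues A = proots (char_poly (map_mat complex_of_real A))"

text \<open>
  In the central graph, \<open>Inl u\<close> is the original vertex \<open>u\<close> and \<open>Inr e\<close> is the vertex
  subdividing the edge \<open>e\<close>.
\<close>

definition central_graph :: "'a pair_pre_digraph \<Rightarrow> ('a + 'a set) pair_pre_digraph" where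
  "central_graph G = \<lparr>
     pverts = Inl ` pverts G \<union> Inr ` edge_set G,
     parcs = {(Inl u, Inr e) | u e. e \<in> edge_set G \<and> u \<in> e}
           \<union> {(Inr e, Inl u) | u e. e \<in> edge_set G \<and> u \<in> e}
           \<union> {(Inl u, Inl v) | u v. u \<in> pverts G \<and> v \<in> pverts G \<and> u \<noteq> v \<and> (u, v) \<notin> parcs G} \<rparr>"

definition central_edge_join ::
    "'a pair_pre_digraph \<Rightarrow> 'b pair_pre_digraph \<Rightarrow> (('a + 'a set) + 'b) pair_pre_digraph" where
  "central_edge_join G\<^sub>1 G\<^sub>2 = \<lparr>
     pverts = Inl ` pverts (central_graph G\<^sub>1) \<union> Inr ` pverts G\<^sub>2,
     parcs = {(Inl x, Inl y) | x y. (x, y) \<in> parcs (central_graph G\<^sub>1)}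
           \<union> {(Inr x, Inr y) | x y. (x, y) \<in> parcs G\<^sub>2}
           \<union> {(Inl (Inr e), Inr y) | e y. e \<in> edge_set G\<^sub>1 \<and> y \<in> pverts G\<^sub>2}
           \<union> {(Inr y, Inl (Inr e)) | e y. e \<in> edge_set G\<^sub>1 \<and> y \<in> pverts G\<^sub>2} \<rparr>"

lemma pair_graphI:
  assumes "finite (pverts G)"
    and "\<And>x y. (x, y) \<in> parcs G \<Longrightarrow> x \<in> pverts G \<and> y \<in> pverts G \<and> x \<noteq> y \<and> (y, x) \<in> parcs G"
  shows "pair_graph G"
proof -
  have "parcs G \<subseteq> pverts G \<times> pverts G"
    using assms(2) by auto
  then have fin: "finite (parcs G)"
    using assms(1) by (meson finite_SigmaI finite_subset)
  have sym: "symmetric (with_proj G)"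
    unfolding symmetric_def with_proj_simps by (rule symI) (use assms(2) in blast)
  show ?thesis
  proof
    fix e assume "e \<in> parcs G"
    then have e: "(fst e, snd e) \<in> parcs G" by simp
    show "fst e \<in> pverts G" "snd e \<in> pverts G" "fst e \<noteq> snd e"
      using assms(2)[OF e] by blast+
  qed (use assms(1) fin sym in blast)+
qed

lemma pair_graphD:
  assumes "pair_graph G" "(x, y) \<in> parcs G"
  shows "x \<in> pverts G" "y \<in> pverts G" "x \<noteq> y" "(y, x) \<in> parcs G"
proof -
  interpret pair_graph G by fact
  show "x \<in> pverts G" "y \<in> pverts G" using assms(2) in_arcsD1 in_arcsD2 by blast+
  show "x \<noteq> y" using pair_no_loops[OF assms(2)] by simp
  show "(y, x) \<in> parcs G"
    using pair_sym_arcs assms(2) unfolding symmetric_def with_proj_simps by (rule symD)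
qed

lemma pair_graph_finite: "pair_graph G \<Longrightarrow> finite (pverts G)"
  using pair_fin_digraph.pair_finite_verts
  unfolding pair_graph_def pair_digraph_def by blast

lemma finite_edge_set:
  assumes "pair_graph G"
  shows "finite (edge_set G)"
proof -
  have "edge_set G \<subseteq> Pow (pverts G)"
    unfolding edge_set_def using pair_graphD[OF assms] by auto
  moreover have "finite (pverts G)"
    using pair_graph_finite[OF assms] .
  ultimately show ?thesis by (meson finite_Pow_iff finite_subset)
qed

lemma pair_graph_central_graph:
  assumes "pair_graph G"
  shows "pair_graph (central_graph G)"
proof (rule pair_graphI, goal_cases)
  case 1
  then show ?case
    using pair_graph_finite[OF assms] finite_edge_set[OF assms] by (simp add: central_graph_def)
next
  case (2 x y)
  have "u \<in> pverts G" if "e \<in> edge_set G" "u \<in> e" for u e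
    using that pair_graphD[OF assms] unfolding edge_set_def by blast
  with 2 show ?case
    using pair_graphD(4)[OF assms] unfolding central_graph_def by auto
qed

lemma pair_graph_central_edge_join:
  assumes "pair_graph G\<^sub>1" "pair_graph G\<^sub>2"
  shows "pair_graph (central_edge_join G\<^sub>1 G\<^sub>2)"
proof (rule pair_graphI, goal_cases)
  case 1
  then show ?case
    using pair_graph_finite[OF pair_graph_central_graph[OF assms(1)]] pair_graph_finite[OF assms(2)]
    by (simp add: central_edge_join_def)
next
  case (2 x y)
  have I: "Inr e \<in> pverts (central_graph G\<^sub>1)" if "e \<in> edge_set G\<^sub>1" for e
    using that by (simp add: central_graph_def)
  from 2 consider
      (a) u v where "x = Inl u" "y = Inl v" "(u, v) \<in> parcs (central_graph G\<^sub>1)"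
    | (b) u v where "x = Inr u" "y = Inr v" "(u, v) \<in> parcs G\<^sub>2"
    | (c) e v where "x = Inl (Inr e)" "y = Inr v" "e \<in> edge_set G\<^sub>1" "v \<in> pverts G\<^sub>2"
    | (d) e v where "x = Inr v" "y = Inl (Inr e)" "e \<in> edge_set G\<^sub>1" "v \<in> pverts G\<^sub>2"
    unfolding central_edge_join_def by auto
  then show ?case
  proof cases
    case a
    then show ?thesis
      using pair_graphD[OF pair_graph_central_graph[OF assms(1)] a(3)]
      by (simp add: central_edge_join_def)
  next
    case b
    then show ?thesis
      using pair_graphD[OF assms(2) b(3)] by (simp add: central_edge_join_def)
  qed (use I in \<open>simp_all add: central_edge_join_def\<close>)
qed

end

theory Submission
  imports Defs "Jordan_Normal_Form.Schur_Decomposition"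
begin

text \<open>
  Any two distinct nonadjacent vertices of the central edge join have a common neighbour and no
  vertex is adjacent to all others, so every eccentricity is 2 and the eccentricity matrix has the
  entry 2 exactly at the pairs of distinct nonadjacent vertices. With respect to the partition into
  the vertices of \<open>G\<^sub>1\<close>, the subdivision vertices and the vertices of \<open>G\<^sub>2\<close> it is \<open>N + U W\<close>, where \<open>U\<close>
  is the indicator matrix of the three parts, \<open>U W\<close> is constant on the blocks, and \<open>N\<close> is block
  diagonal: \<open>N\<^sub>1\<close> with blocks \<open>2A\<^sub>1, -2B, -2B\<^sup>T, -2I\<close> for the incidence matrix \<open>B\<close> of \<open>G\<^sub>1\<close>, and
  \<open>-2I - 2A\<^sub>2\<close>. Regularity gives \<open>N U = U Q\<close> for a 3 by 3 matrix \<open>Q\<close>, and a similarity of block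
  matrices yields \<open>\<chi>(N + U W) \<chi>(Q) = \<chi>(N) \<chi>(Q + W U)\<close>. Here \<open>Q + W U\<close> is the matrix of item (4), the
  factor \<open>\<chi>(N\<^sub>1)\<close> follows from \<open>B B\<^sup>T = A\<^sub>1 + r\<^sub>1 I\<close> by a Schur complement, and \<open>\<chi>(Q)\<close> cancels the
  factors belonging to the eigenvalues \<open>r\<^sub>1\<close> and \<open>r\<^sub>2\<close>. The radicands in (3) are nonnegative because
  \<open>\<lambda>\<^sub>i \<ge> -r\<^sub>1\<close>.
\<close>

subsection \<open>Matrices indexed by lists\<close>

text \<open>Entries are given as a function of the list elements instead of their positions.
  Vertices and edges can then index rows and columns directly, and for distinct lists a matrix
  product becomes a sum over a finite set.\<close>

definition indexed_mat :: "('i \<Rightarrow> 'j \<Rightarrow> 'c) \<Rightarrow> 'i list \<Rightarrow> 'j list \<Rightarrow> 'c mat" where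
  "indexed_mat f us vs = mat (length us) (length vs) (\<lambda>(i, j). f (us ! i) (vs ! j))"

lemma indexed_mat_carrier [simp]:
  "indexed_mat f us vs \<in> carrier_mat (length us) (length vs)"
  by (simp add: indexed_mat_def)

lemma indexed_mat_cong:
  assumes "\<And>u v. u \<in> set us \<Longrightarrow> v \<in> set vs \<Longrightarrow> f u v = g u v"
  shows "indexed_mat f us vs = indexed_mat g us vs"
  by (rule eq_matI) (auto simp: indexed_mat_def assms)

lemma map_mat_indexed_mat: "map_mat h (indexed_mat f us vs) = indexed_mat (\<lambda>u v. h (f u v)) us vs"
  by (rule eq_matI) (auto simp: indexed_mat_def)

lemma transpose_indexed_mat: "(indexed_mat f us vs)\<^sup>T = indexed_mat (\<lambda>v u. f u v) vs us"
  by (rule eq_matI) (auto simp: indexed_mat_def)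

lemma indexed_mat_map:
  "indexed_mat f (map g us) (map h vs) = indexed_mat (\<lambda>u v. f (g u) (h v)) us vs"
  by (rule eq_matI) (auto simp: indexed_mat_def)

lemma indexed_mat_append:
  "indexed_mat f (us @ us') (vs @ vs') =
     four_block_mat (indexed_mat f us vs) (indexed_mat f us vs')
       (indexed_mat f us' vs) (indexed_mat f us' vs')"
  by (rule eq_matI) (auto simp: indexed_mat_def nth_append)

lemma indexed_mat_add:
  "indexed_mat f us vs + indexed_mat g us vs = indexed_mat (\<lambda>u v. f u v + g u v) us vs"
  by (rule eq_matI) (auto simp: indexed_mat_def)

lemma indexed_mat_smult:
  "c \<cdot>\<^sub>m indexed_mat f us vs = indexed_mat (\<lambda>u v. c * f u v) us vs"
  by (rule eq_matI) (auto simp: indexed_mat_def)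

lemma sum_nth_distinct:
  assumes "distinct xs"
  shows "(\<Sum>i = 0..<length xs. g (xs ! i)) = (\<Sum>x\<in>set xs. g x)"
  using sum.reindex_bij_betw[OF bij_betw_nth[OF assms refl refl], of g]
  by (simp add: atLeast0LessThan)

lemma indexed_mat_mult:
  assumes "distinct vs"
  shows "indexed_mat f us vs * indexed_mat g vs ws =
           indexed_mat (\<lambda>u w. \<Sum>v\<in>set vs. f u v * g v w) us ws"
  by (rule eq_matI)
    (auto simp: indexed_mat_def scalar_prod_def sum_nth_distinct[OF assms, symmetric])

lemma one_indexed_mat:
  assumes "distinct us"
  shows "indexed_mat (\<lambda>u v. of_bool (u = v)) us us = 1\<^sub>m (length us)"
  by (rule eq_matI) (auto simp: indexed_mat_def nth_eq_iff_index_eq[OF assms])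

lemma zero_indexed_mat: "indexed_mat (\<lambda>_ _. 0) us vs = 0\<^sub>m (length us) (length vs)"
  by (rule eq_matI) (auto simp: indexed_mat_def)

text \<open>The two matrices are conjugate by the permutation matrix relating the enumerations, with
  inverse its transpose. This allows the spectrum to be computed for an ordering of the vertices
  that exhibits the block structure.\<close>

lemma char_poly_indexed_mat_reorder:
  fixes f :: "'i \<Rightarrow> 'i \<Rightarrow> 'c::comm_ring_1"
  assumes "distinct us" "distinct vs" "set us = set vs"
  shows "char_poly (indexed_mat f us us) = char_poly (indexed_mat f vs vs)"
proof (rule char_poly_similar, rule similar_matI)
  have len: "length us = length vs"
    using assms by (metis distinct_card)
  define P :: "'c mat" where "P = indexed_mat (\<lambda>u v. of_bool (u = v)) us vs"
  define Q :: "'c mat" where "Q = indexed_mat (\<lambda>u v. of_bool (u = v)) vs us"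
  have s1: "(\<Sum>v\<in>set vs. of_bool (x = v) * g v) = g x" if "x \<in> set vs" for x and g :: "'i \<Rightarrow> 'c"
    using that by (simp add: sum.delta of_bool_def if_distrib[of "\<lambda>c. c * _"] cong: if_cong)
  have s2: "(\<Sum>v\<in>set vs. g v * of_bool (v = x)) = g x" if "x \<in> set vs" for x and g :: "'i \<Rightarrow> 'c"
    using that by (simp add: sum.delta of_bool_def if_distrib[of "\<lambda>c. _ * c"] cong: if_cong)
  show "{indexed_mat f us us, indexed_mat f vs vs, P, Q} \<subseteq> carrier_mat (length vs) (length vs)"
    unfolding P_def Q_def using len by (metis indexed_mat_carrier insert_subset empty_subsetI)
  show "P * Q = 1\<^sub>m (length vs)"
    unfolding P_def Q_def indexed_mat_mult[OF assms(2)] len[symmetric]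
      one_indexed_mat[OF assms(1), symmetric]
    by (rule indexed_mat_cong) (use assms s1 in auto)
  show "Q * P = 1\<^sub>m (length vs)"
    unfolding P_def Q_def indexed_mat_mult[OF assms(1)] one_indexed_mat[OF assms(2), symmetric]
    unfolding assms(3)
    by (rule indexed_mat_cong) (use assms s1 in auto)
  show "indexed_mat f us us = P * indexed_mat f vs vs * Q"
    unfolding P_def Q_def indexed_mat_mult[OF assms(2)]
    by (rule indexed_mat_cong) (simp add: s1 s2 assms(3))
qed

section \<open>Block triangular matrices and low rank updates\<close>

lemma char_poly_four_block_upper_right_zero:
  fixes A :: "'c::idom mat"
  assumes "A \<in> carrier_mat n n" "C \<in> carrier_mat m n" "D \<in> carrier_mat m m"
  shows "char_poly (four_block_mat A (0\<^sub>m n m) C D) = char_poly A * char_poly D"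
proof -
  have "char_poly_matrix (four_block_mat A (0\<^sub>m n m) C D) =
    four_block_mat (char_poly_matrix A) (0\<^sub>m n m) (map_mat (\<lambda>a. [:- a:]) C) (char_poly_matrix D)"
    by (rule eq_matI) (use assms in \<open>auto simp: char_poly_matrix_def\<close>)
  then show ?thesis
    unfolding char_poly_def using assms
    by (simp add: det_four_block_mat_upper_right_zero[of _ n _ m])
qed

text \<open>The matrices \<open>L\<close> with rows \<open>N + U W, 0\<close> and
  \<open>- W, Q\<close> and \<open>R\<close> with rows \<open>N, 0\<close> and
  \<open>- W, Q + W U\<close> are conjugate by the shear \<open>P\<close>, that is,
  \<open>L P = P R\<close>. Both are block triangular, so comparing characteristic polynomials gives
  the identity without any division.\<close>

lemma char_poly_equitable_update:
  fixes N :: "'c::idom mat"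
  assumes N: "N \<in> carrier_mat n n" and U: "U \<in> carrier_mat n k"
    and W: "W \<in> carrier_mat k n" and Q: "Q \<in> carrier_mat k k"
    and NU: "N * U = U * Q"
  shows "char_poly (N + U * W) * char_poly Q = char_poly N * char_poly (Q + W * U)"
proof -
  define P where "P = four_block_mat (1\<^sub>m n) (- U) (0\<^sub>m k n) (1\<^sub>m k)"
  define P' where "P' = four_block_mat (1\<^sub>m n) U (0\<^sub>m k n) (1\<^sub>m k)"
  define L where "L = four_block_mat (N + U * W) (0\<^sub>m n k) (- W) Q"
  define R where "R = four_block_mat N (0\<^sub>m n k) (- W) (Q + W * U)"
  note [simp] = N U W Q
  note dims = U[THEN carrier_matD(1)] U[THEN carrier_matD(2)] 
    W[THEN carrier_matD(1)] W[THEN carrier_matD(2)]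
  have shear: "four_block_mat (1\<^sub>m n) X (0\<^sub>m k n) (1\<^sub>m k) *
      four_block_mat (1\<^sub>m n) Y (0\<^sub>m k n) (1\<^sub>m k) = 1\<^sub>m (n + k)"
    if [simp]: "X \<in> carrier_mat n k" "Y \<in> carrier_mat n k" and 0: "Y + X = 0\<^sub>m n k"
    for X Y :: "'c mat"
    by (subst mult_four_block_mat[of _ n n _ k _ k _ _ n _ k])
      (simp_all add: 0 right_mult_zero_mat[OF that(1)] left_mult_zero_mat[OF that(2)]
        left_mult_one_mat[OF that(2)] right_mult_one_mat[OF that(1)])
  have PP: "P * P' = 1\<^sub>m (n + k)" "P' * P = 1\<^sub>m (n + k)"
    unfolding P_def P'_def by (rule shear; auto intro!: eq_matI simp: dims)+
  have UW: "U * W \<in> carrier_mat n n" "W * U \<in> carrier_mat k k"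
    by (rule mult_carrier_mat[OF U W], rule mult_carrier_mat[OF W U])
  have "P * R = four_block_mat (1\<^sub>m n * N + (- U) * (- W)) (1\<^sub>m n * 0\<^sub>m n k + (- U) * (Q + W * U))
     (0\<^sub>m k n * N + 1\<^sub>m k * (- W)) (0\<^sub>m k n * 0\<^sub>m n k + 1\<^sub>m k * (Q + W * U))"
    unfolding P_def R_def
    by (rule mult_four_block_mat[of _ n n _ k _ k _ _ n _ k]) (use N U W Q UW in auto)
  also have "\<dots> = four_block_mat (N + U * W) (- (U * Q) - U * W * U) (- W) (Q + W * U)"
  proof (rule cong_four_block_mat)
    have "- U * (Q + W * U) = - (U * (Q + W * U))"
      by (rule uminus_mult_left_mat) (simp add: dims)
    also have "U * (Q + W * U) = U * Q + U * (W * U)"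
      by (rule mult_add_distrib_mat[OF U Q UW(2)])
    also have "U * (W * U) = U * W * U"
      by (rule assoc_mult_mat[symmetric, OF U W U])
    finally have "- U * (Q + W * U) = - (U * Q + U * W * U)" .
    moreover have "0\<^sub>m n k + - (X + Y) = - X - Y"
      if "X \<in> carrier_mat n k" "Y \<in> carrier_mat n k" for X Y :: "'c mat"
      using that by (auto intro!: eq_matI)
    ultimately show "1\<^sub>m n * 0\<^sub>m n k + - U * (Q + W * U) = - (U * Q) - U * W * U"
      using mult_carrier_mat[OF U Q] mult_carrier_mat[OF UW(1) U]
      by (simp add: left_add_zero_mat[of _ n k] minus_carrier_mat)
    have "- U * - W = U * W"
      by (rule eq_matI) (simp_all add: dims)
    then show "1\<^sub>m n * N + - U * - W = N + U * W"
      by (simp add: left_mult_one_mat[OF N])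
    show "0\<^sub>m k n * N + 1\<^sub>m k * - W = - W"
      by (simp add: left_mult_zero_mat[OF N] left_mult_one_mat[of _ k n] left_add_zero_mat[of _ k n])
    show "0\<^sub>m k n * 0\<^sub>m n k + 1\<^sub>m k * (Q + W * U) = Q + W * U"
      using UW(2) by (simp add: left_mult_one_mat[of _ k k] left_add_zero_mat[of _ k k])
  qed
  finally have 1: "P * R = four_block_mat (N + U * W) (- (U * Q) - U * W * U) (- W) (Q + W * U)" .
  have "L * P = four_block_mat ((N + U * W) * 1\<^sub>m n + 0\<^sub>m n k * 0\<^sub>m k n)
     ((N + U * W) * (- U) + 0\<^sub>m n k * 1\<^sub>m k)
     ((- W) * 1\<^sub>m n + Q * 0\<^sub>m k n) ((- W) * (- U) + Q * 1\<^sub>m k)"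
    unfolding P_def L_def
    by (rule mult_four_block_mat[of _ n n _ k _ k _ _ n _ k]) (use N U W Q UW in auto)
  also have "\<dots> = P * R"
    unfolding 1
  proof (rule cong_four_block_mat)
    \<comment> \<open>The upper right block is the only one in which \<open>N U = U Q\<close> is
      needed.\<close>
    have "(N + U * W) * (- U) = - ((N + U * W) * U)"
      by (rule uminus_mult_right_mat) (simp add: dims)
    also have "(N + U * W) * U = N * U + U * W * U"
      by (rule add_mult_distrib_mat[OF N UW(1) U])
    finally have "(N + U * W) * (- U) = - (U * Q + U * W * U)"
      unfolding NU .
    moreover have "- (X + Y) + 0\<^sub>m n k = - X - Y"
      if "X \<in> carrier_mat n k" "Y \<in> carrier_mat n k" for X Y :: "'c mat"
      using that by (auto intro!: eq_matI)
    ultimately show "(N + U * W) * (- U) + 0\<^sub>m n k * 1\<^sub>m k = - (U * Q) - U * W * U"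
      using mult_carrier_mat[OF U Q] mult_carrier_mat[OF UW(1) U]
      by (simp add: right_add_zero_mat[of _ n k] minus_carrier_mat)
    have "- W * - U = W * U"
      by (rule eq_matI) (simp_all add: dims)
    then show "- W * - U + Q * 1\<^sub>m k = Q + W * U"
      using comm_add_mat[OF UW(2) Q] by (simp add: right_mult_one_mat[OF Q])
    show "(N + U * W) * 1\<^sub>m n + 0\<^sub>m n k * 0\<^sub>m k n = N + U * W"
      using UW(1) by (simp add: right_mult_one_mat[of _ n n] right_add_zero_mat[of _ n n])
    show "- W * 1\<^sub>m n + Q * 0\<^sub>m k n = - W"
      by (simp add: right_mult_one_mat[of _ k n] right_mult_zero_mat[OF Q] right_add_zero_mat[of _ k n])
  qed
  finally have LP: "L * P = P * R" .
  have carr: "L \<in> carrier_mat (n + k) (n + k)" "R \<in> carrier_mat (n + k) (n + k)"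
    "P \<in> carrier_mat (n + k) (n + k)" "P' \<in> carrier_mat (n + k) (n + k)"
    unfolding L_def R_def P_def P'_def
    using four_block_carrier_mat[OF add_carrier_mat[OF UW(1)] Q]
      four_block_carrier_mat[OF N add_carrier_mat[OF UW(2)]]
      four_block_carrier_mat[OF one_carrier_mat one_carrier_mat]
    by blast+
  have "L = L * (P * P')"
    by (simp only: PP right_mult_one_mat[OF carr(1)])
  also have "\<dots> = P * R * P'"
    unfolding LP[symmetric] by (rule assoc_mult_mat[symmetric, OF carr(1,3,4)])
  finally have "similar_mat L R"
    by (intro similar_matI[of _ _ P P' "n + k"]) (use carr PP in blast)+
  then have "char_poly L = char_poly R" by (rule char_poly_similar)
  then show ?thesis
    unfolding L_def R_def
      char_poly_four_block_upper_right_zero[OF add_carrier_mat[OF UW(1)] uminus_carrier_mat[OF W] Q]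
      char_poly_four_block_upper_right_zero[OF N uminus_carrier_mat[OF W] add_carrier_mat[OF UW(2)]] .
qed

subsection \<open>Determinants and characteristic polynomials\<close>

text \<open>This is the Schur complement with denominators cleared: multiplying by the block
  triangular \<open>S\<close>, of determinant \<open>c ^ p\<close>, kills the lower left block
  because \<open>c Z - c Z = 0\<close>. Hence it also holds for \<open>c = 0\<close>.\<close>

lemma det_four_block_scalar:
  fixes X :: "'c::idom mat"
  assumes X: "X \<in> carrier_mat p p" and Y: "Y \<in> carrier_mat p q" and Z: "Z \<in> carrier_mat q p"
  shows "det (four_block_mat X Y Z (c \<cdot>\<^sub>m 1\<^sub>m q)) * c ^ p = det (c \<cdot>\<^sub>m X - Y * Z) * c ^ q"
proof -
  define S where "S = four_block_mat (c \<cdot>\<^sub>m 1\<^sub>m p) (0\<^sub>m p q) (- Z) (1\<^sub>m q)"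
  note [simp] = X Y Z
  have YZ: "Y * Z \<in> carrier_mat p p" by (rule mult_carrier_mat[OF Y Z])
  have "four_block_mat X Y Z (c \<cdot>\<^sub>m 1\<^sub>m q) * S =
    four_block_mat (X * (c \<cdot>\<^sub>m 1\<^sub>m p) + Y * (- Z)) (X * 0\<^sub>m p q + Y * 1\<^sub>m q)
      (Z * (c \<cdot>\<^sub>m 1\<^sub>m p) + (c \<cdot>\<^sub>m 1\<^sub>m q) * (- Z)) (Z * 0\<^sub>m p q + (c \<cdot>\<^sub>m 1\<^sub>m q) * 1\<^sub>m q)"
    unfolding S_def
    by (rule mult_four_block_mat[of _ p p _ q _ q _ _ p _ q]) (use X Y Z in auto)
  also have "\<dots> = four_block_mat (c \<cdot>\<^sub>m X - Y * Z) Y (0\<^sub>m q p) (c \<cdot>\<^sub>m 1\<^sub>m q)"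
  proof (rule cong_four_block_mat)
    have "X * (c \<cdot>\<^sub>m 1\<^sub>m p) = c \<cdot>\<^sub>m X"
      by (simp add: mult_smult_distrib[OF X one_carrier_mat] right_mult_one_mat[OF X])
    moreover have "Y * (- Z) = - (Y * Z)"
      by (rule uminus_mult_right_mat) (simp add: Y[THEN carrier_matD(2)] Z[THEN carrier_matD(1)])
    ultimately show "X * (c \<cdot>\<^sub>m 1\<^sub>m p) + Y * (- Z) = c \<cdot>\<^sub>m X - Y * Z"
      using YZ X by (auto intro!: eq_matI)
    have "Z * (c \<cdot>\<^sub>m 1\<^sub>m p) = c \<cdot>\<^sub>m Z"
      by (simp add: mult_smult_distrib[OF Z one_carrier_mat] right_mult_one_mat[OF Z])
    moreover have "(c \<cdot>\<^sub>m 1\<^sub>m q) * (- Z) = c \<cdot>\<^sub>m (- Z)"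
      using Z by (simp add: mult_smult_assoc_mat[OF one_carrier_mat, of "- Z" q p]
          left_mult_one_mat[of _ q p])
    ultimately have "Z * (c \<cdot>\<^sub>m 1\<^sub>m p) + (c \<cdot>\<^sub>m 1\<^sub>m q) * (- Z) = c \<cdot>\<^sub>m Z + c \<cdot>\<^sub>m (- Z)"
      by (simp only:)
    also have "\<dots> = 0\<^sub>m q p"
      by (rule eq_matI) (simp_all add: Z[THEN carrier_matD(1)] Z[THEN carrier_matD(2)])
    finally show "Z * (c \<cdot>\<^sub>m 1\<^sub>m p) + (c \<cdot>\<^sub>m 1\<^sub>m q) * (- Z) = 0\<^sub>m q p" .
  qed (auto simp: right_mult_one_mat[OF Y] right_mult_zero_mat[OF X] right_mult_zero_mat[OF Z])
  finally have "det (four_block_mat X Y Z (c \<cdot>\<^sub>m 1\<^sub>m q) * S) = det (c \<cdot>\<^sub>m X - Y * Z) * c ^ q"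
    using YZ by (simp add: det_four_block_mat_lower_left_zero[of _ p _ q] minus_carrier_mat)
  moreover have "det S = c ^ p"
    unfolding S_def by (simp add: det_four_block_mat_upper_right_zero[of _ p _ q])
  moreover have "det (four_block_mat X Y Z (c \<cdot>\<^sub>m 1\<^sub>m q) * S) =
      det (four_block_mat X Y Z (c \<cdot>\<^sub>m 1\<^sub>m q)) * det S"
    by (rule det_mult[of _ "p + q"]) (auto simp: S_def)
  ultimately show ?thesis by simp
qed

text \<open>For nonzero \<open>b\<close> the matrix is \<open>b\<close> times
  \<open>(a / b) I - A\<close>, so its determinant is \<open>b ^ n\<close> times the characteristic
  polynomial of \<open>A\<close> at \<open>a / b\<close>. For \<open>b = 0\<close> both sides are
  \<open>a ^ n\<close>.\<close>

lemma det_linear_combination: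
  fixes A :: "'c::field mat"
  assumes A: "A \<in> carrier_mat n n" and char_poly: "char_poly A = (\<Prod>x\<in>#M. [:- x, 1:])"
  shows "det (a \<cdot>\<^sub>m 1\<^sub>m n - b \<cdot>\<^sub>m A) = (\<Prod>x\<in>#M. a - b * x)"
proof -
  \<comment> \<open>Comparing degrees shows that \<open>M\<close> has exactly \<open>n\<close>
    elements, so that \<open>b ^ n\<close> can be spread over the factors and the case
    \<open>b = 0\<close> comes out right.\<close>
  have "degree (\<Prod>x\<in>#M. [:- x, 1:]) = size M \<and> (\<Prod>x\<in>#M. [:- x, 1:]) \<noteq> 0"
    by (induction M) (auto simp: degree_mult_eq simp del: mult_pCons_left)
  with degree_monic_char_poly[OF A] char_poly have size: "size M = n" by simp
  show ?thesis
  proof (cases "b = 0")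
    case True
    have "a \<cdot>\<^sub>m 1\<^sub>m n - b \<cdot>\<^sub>m A = a \<cdot>\<^sub>m 1\<^sub>m n"
      using A True by (auto intro!: eq_matI)
    then show ?thesis
      using True by (simp add: size prod_mset_constant)
  next
    case False
    have "a \<cdot>\<^sub>m 1\<^sub>m n - b \<cdot>\<^sub>m A = b \<cdot>\<^sub>m (- char_matrix A (a / b))"
      using A False by (auto intro!: eq_matI simp: char_matrix_def field_simps)
    then have "det (a \<cdot>\<^sub>m 1\<^sub>m n - b \<cdot>\<^sub>m A) = b ^ n * poly (char_poly A) (a / b)"
      using A by (simp add: char_poly_matrix[OF A] char_matrix_def)
    also have "poly (char_poly A) (a / b) = (\<Prod>x\<in>#M. a / b - x)"
      unfolding char_poly by (simp add: poly_prod_mset)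
    also have "b ^ n * \<dots> = (\<Prod>x\<in>#M. b * (a / b - x))"
      by (simp add: prod_mset.distrib size prod_mset_constant)
    also have "\<dots> = (\<Prod>x\<in>#M. a - b * x)"
      using False by (simp add: algebra_simps)
    finally show ?thesis .
  qed
qed

lemma char_poly_affine:
  fixes A :: "'c::{field, ring_char_0} mat"
  assumes A: "A \<in> carrier_mat n n" and char_poly: "char_poly A = (\<Prod>x\<in>#M. [:- x, 1:])"
  shows "char_poly (a \<cdot>\<^sub>m 1\<^sub>m n + b \<cdot>\<^sub>m A) = (\<Prod>x\<in>#M. [:- (a + b * x), 1:])"
proof (rule poly_ext)
  fix k
  have carr: "a \<cdot>\<^sub>m 1\<^sub>m n + b \<cdot>\<^sub>m A \<in> carrier_mat n n"
    using A by auto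
  have "- char_matrix (a \<cdot>\<^sub>m 1\<^sub>m n + b \<cdot>\<^sub>m A) k = (k - a) \<cdot>\<^sub>m 1\<^sub>m n - b \<cdot>\<^sub>m A"
    by (rule eq_matI) (use A in \<open>auto simp: char_matrix_def\<close>)
  then show "poly (char_poly (a \<cdot>\<^sub>m 1\<^sub>m n + b \<cdot>\<^sub>m A)) k = poly (\<Prod>x\<in>#M. [:- (a + b * x), 1:]) k"
    by (simp add: char_poly_matrix[OF carr] det_linear_combination[OF A char_poly] poly_prod_mset
        algebra_simps)
qed

text \<open>At a point \<open>k\<close>, the Schur complement with respect to the lower right block
  is linear in \<open>A\<close>, because \<open>B B\<^sup>T\<close> is \<open>A + r I\<close>. Its
  determinant is therefore a product over the eigenvalues of \<open>A\<close>. The powers of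
  \<open>[:2, 1:]\<close> on both sides avoid a quotient.\<close>

lemma char_poly_incidence_block:
  fixes A :: "'c::{field, ring_char_0} mat"
  assumes A: "A \<in> carrier_mat p p" and B: "B \<in> carrier_mat p q"
    and BB: "B * B\<^sup>T = A + r \<cdot>\<^sub>m 1\<^sub>m p"
    and char_poly: "char_poly A = (\<Prod>x\<in>#M. [:- x, 1:])"
  shows "char_poly (four_block_mat (2 \<cdot>\<^sub>m A) (- 2 \<cdot>\<^sub>m B) (- 2 \<cdot>\<^sub>m B\<^sup>T) (- 2 \<cdot>\<^sub>m 1\<^sub>m q))
      * [:2, 1:] ^ p =
    (\<Prod>x\<in>#M. [:- 2 * x, 1:] * [:2, 1:] - [:4 * (x + r):]) * [:2, 1:] ^ q"
    (is "char_poly ?N * _ = ?R")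
proof -
  have N: "?N \<in> carrier_mat (p + q) (p + q)"
    using A B by auto
  have "poly (char_poly ?N * [:2, 1:] ^ p) k = poly ?R k" for k
  proof -
    \<comment> \<open>The left side is \<open>k I - ?N\<close>. Its lower right block is the scalar
      matrix \<open>(k + 2) I\<close>, as the Schur complement requires; \<open>k = -2\<close> is no
      exception.\<close>
    have "- char_matrix ?N k =
        four_block_mat (k \<cdot>\<^sub>m 1\<^sub>m p - 2 \<cdot>\<^sub>m A) (2 \<cdot>\<^sub>m B) (2 \<cdot>\<^sub>m B\<^sup>T) ((k + 2) \<cdot>\<^sub>m 1\<^sub>m q)"
      by (rule eq_matI) (use A B in \<open>auto simp: char_matrix_def\<close>)
    then have "poly (char_poly ?N * [:2, 1:] ^ p) k =
        det (four_block_mat (k \<cdot>\<^sub>m 1\<^sub>m p - 2 \<cdot>\<^sub>m A) (2 \<cdot>\<^sub>m B) (2 \<cdot>\<^sub>m B\<^sup>T) ((k + 2) \<cdot>\<^sub>m 1\<^sub>m q))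
          * (k + 2) ^ p"
      by (simp add: char_poly_matrix[OF N] add.commute)
    also have "\<dots> = det ((k + 2) \<cdot>\<^sub>m (k \<cdot>\<^sub>m 1\<^sub>m p - 2 \<cdot>\<^sub>m A) - (2 \<cdot>\<^sub>m B) * (2 \<cdot>\<^sub>m B\<^sup>T)) * (k + 2) ^ q"
      by (rule det_four_block_scalar) (use A B in \<open>auto intro: minus_carrier_mat\<close>)
    also have "(2 \<cdot>\<^sub>m B) * (2 \<cdot>\<^sub>m B\<^sup>T) = 4 \<cdot>\<^sub>m (B * B\<^sup>T)"
      using B by (auto intro!: eq_matI)
    also have "(k + 2) \<cdot>\<^sub>m (k \<cdot>\<^sub>m 1\<^sub>m p - 2 \<cdot>\<^sub>m A) - 4 \<cdot>\<^sub>m (B * B\<^sup>T) =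
        ((k + 2) * k - 4 * r) \<cdot>\<^sub>m 1\<^sub>m p - (2 * (k + 2) + 4) \<cdot>\<^sub>m A"
      unfolding BB by (rule eq_matI) (use A in \<open>auto simp: algebra_simps\<close>)
    also have "det \<dots> = (\<Prod>x\<in>#M. (k + 2) * k - 4 * r - (2 * (k + 2) + 4) * x)"
      by (rule det_linear_combination[OF A char_poly])
    also have "\<dots> = (\<Prod>x\<in>#M. poly ([:- 2 * x, 1:] * [:2, 1:] - [:4 * (x + r):]) k)"
      by (simp add: algebra_simps)
    also have "\<dots> * (k + 2) ^ q = poly ?R k"
      by (simp add: poly_prod_mset add.commute)
    finally show ?thesis .
  qed
  then show ?thesis
    by (intro poly_ext)
qed

text \<open>A Gershgorin argument: read the eigenvector equation at a coordinate of maximal modulus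
  \<open>m\<close>, which is positive since the eigenvector is nonzero, and divide by
  \<open>m\<close>.\<close>

lemma eigenvalue_norm_le_row_sum:
  fixes A :: "'c::real_normed_field mat"
  assumes A: "A \<in> carrier_mat n n" and ev: "eigenvalue A k"
    and row: "\<And>i. i < n \<Longrightarrow> (\<Sum>j<n. norm (A $$ (i, j))) \<le> r"
  shows "norm k \<le> r"
proof -
  obtain v where v: "v \<in> carrier_vec n" "v \<noteq> 0\<^sub>v n" "A *\<^sub>v v = k \<cdot>\<^sub>v v"
    using ev A unfolding eigenvalue_def eigenvector_def by auto
  have ne: "{..<n} \<noteq> {}"
    using v by (auto simp: lessThan_empty_iff)
  define m where "m = Max ((\<lambda>i. norm (v $ i)) ` {..<n})"
  have le: "norm (v $ j) \<le> m" if "j < n" for j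
    unfolding m_def using that by (intro Max_ge) auto
  have "m \<in> (\<lambda>i. norm (v $ i)) ` {..<n}"
    unfolding m_def using ne by (intro Max_in) auto
  then obtain i where i: "i < n" "norm (v $ i) = m" by auto
  have "m > 0"
  proof (rule ccontr)
    assume "\<not> m > 0"
    then have "v $ j = 0" if "j < n" for j
      using le[OF that] by (metis norm_le_zero_iff not_less order_trans)
    then show False using v by (auto intro!: eq_vecI)
  qed
  have "k * v $ i = (A *\<^sub>v v) $ i"
    using v i by (metis carrier_vecD index_smult_vec(1))
  also have "\<dots> = (\<Sum>j<n. A $$ (i, j) * v $ j)"
    using A v(1) i(1) by (simp add: scalar_prod_def atLeast0LessThan)
  finally have "norm k * m = norm (\<Sum>j<n. A $$ (i, j) * v $ j)"
    using i by (metis norm_mult)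
  also have "\<dots> \<le> (\<Sum>j<n. norm (A $$ (i, j)) * m)"
    by (rule order_trans[OF norm_sum sum_mono]) (auto simp: norm_mult intro!: mult_left_mono le)
  also have "\<dots> \<le> r * m"
    using row[OF i(1)] \<open>m > 0\<close> by (simp add: sum_distrib_right[symmetric])
  finally show ?thesis
    using \<open>m > 0\<close> by simp
qed

section \<open>Characteristic polynomials and their multisets of roots\<close>

lemma prod_linear_nonzero: "(\<Prod>x\<in>#M. [:- x, 1:]) \<noteq> (0 :: 'c::idom poly)"
  by (induction M) (auto simp del: mult_pCons_left)

lemma proots_prod_linear: "proots (\<Prod>x\<in>#M. [:- x, 1:]) = (M :: 'c::idom multiset)"
proof (induction M)
  case (add x M)
  have "proots ([:- x, 1:] * (\<Prod>x\<in>#M. [:- x, 1:])) = proots [:- x, 1:] + proots (\<Prod>x\<in>#M. [:- x, 1:])"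
    by (rule proots_mult[OF _ prod_linear_nonzero]) simp
  then show ?case
    using add by (simp del: mult_pCons_left)
qed simp

text \<open>Over the complex numbers the characteristic polynomial is monic and splits. A statement
  about \<open>eigenvalues\<close> can thus be turned into a factorization.\<close>

lemma char_poly_eq_prod_proots:
  fixes A :: "complex mat"
  assumes "A \<in> carrier_mat n n"
  shows "char_poly A = (\<Prod>x\<in>#proots (char_poly A). [:- x, 1:])"
proof -
  obtain as where as: "char_poly A = (\<Prod>a\<leftarrow>as. [:- a, 1:])"
    using char_poly_factorized[OF assms] by blast
  have "char_poly A = (\<Prod>a\<in>#mset as. [:- a, 1:])"
    unfolding as by (simp flip: prod_mset_prod_list)
  then show ?thesis
    using proots_prod_linear[of "mset as"] by simp
qed

lemma char_poly_2:
  fixes A :: "'c::idom mat"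
  assumes "A \<in> carrier_mat 2 2"
  shows "char_poly A = [:- A $$ (0,0), 1:] * [:- A $$ (1,1), 1:] - [:A $$ (0,1) * A $$ (1,0):]"
proof -
  have *: "char_poly_matrix A = four_block_mat
     (mat 1 1 (\<lambda>_. [:- A $$ (0,0), 1:])) (mat 1 1 (\<lambda>_. [:- A $$ (0,1):]))
     (mat 1 1 (\<lambda>_. [:- A $$ (1,0):])) (mat 1 1 (\<lambda>_. [:- A $$ (1,1), 1:]))"
    by (rule eq_matI) (use assms in \<open>auto simp: char_poly_matrix_def less_Suc_eq numeral_2_eq_2\<close>)
  show ?thesis
    unfolding char_poly_def *
    by (subst det_four_block_mat[of _ 1])
      (simp_all add: scalar_prod_def mat_eq_iff, subst det_single, auto simp: scalar_prod_def)
qed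

subsection \<open>Eccentricity matrices of graphs of diameter two\<close>

lemma wf_digraph_pair_graph: "pair_graph G \<Longrightarrow> wf_digraph (with_proj G)"
  unfolding wf_digraph_def using pair_graphD(1,2)[of G] by force

lemmas awalk_simps =
  wf_digraph.awalk_Nil_iff[OF wf_digraph_pair_graph]
  wf_digraph.awalk_Cons_iff[OF wf_digraph_pair_graph]

text \<open>With unit weights the cost of a walk is its length, so the infimum defining the distance
  is attained at a shortest walk. In particular it is finite, and the conversion to a real number is
  faithful.\<close>

lemma gdist_eqI:
  assumes G: "pair_graph G" and walk: "pre_digraph.awalk (with_proj G) u w v"
    and min: "\<And>w'. pre_digraph.awalk (with_proj G) u w' v \<Longrightarrow> length w \<le> length w'"
  shows "gdist G u v = length w"
proof -
  note wf = wf_digraph_pair_graph[OF G]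
  have cost: "wf_digraph.awalk_cost (\<lambda>_. 1) p = length p" for p :: "('a \<times> 'a) list"
    using wf_digraph.awalk_cost_def[OF wf, of "\<lambda>_. 1" p] by (simp add: sum_list_triv)
  have "wf_digraph.\<mu> (with_proj G) (\<lambda>_. 1) u v \<le> ereal (length w)"
    using wf_digraph.min_cost_le_walk_cost[OF wf walk, of "\<lambda>_. 1"] by (simp add: cost)
  moreover have "ereal (length w) \<le> wf_digraph.\<mu> (with_proj G) (\<lambda>_. 1) u v"
    unfolding wf_digraph.\<mu>_def[OF wf] by (intro INF_greatest) (use min in \<open>auto simp: cost\<close>)
  ultimately show ?thesis
    unfolding gdist_def by (metis antisym real_of_ereal.simps(1))
qed

lemma gdist_self:
  assumes "pair_graph G" "u \<in> pverts G"
  shows "gdist G u u = 0"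
  using gdist_eqI[of G u "[]" u] assms by (simp add: awalk_simps)

lemma gdist_adjacent:
  assumes "pair_graph G" "(u, v) \<in> parcs G"
  shows "gdist G u v = 1"
proof -
  note v = pair_graphD[OF assms]
  have "Suc 0 \<le> length w" if "pre_digraph.awalk (with_proj G) u w v" for w
    using that v(3) assms(1) by (cases w) (auto simp: awalk_simps)
  then show ?thesis
    using gdist_eqI[of G u "[(u, v)]" v] assms v by (simp add: awalk_simps)
qed

lemma gdist_two:
  assumes "pair_graph G" "u \<noteq> v" "(u, v) \<notin> parcs G" "(u, m) \<in> parcs G" "(m, v) \<in> parcs G"
  shows "gdist G u v = 2"
proof -
  have "2 \<le> length w" if "pre_digraph.awalk (with_proj G) u w v" for w
  proof (rule ccontr)
    assume "\<not> 2 \<le> length w"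
    then consider "w = []" | e where "w = [e]"
      by (cases w; cases "tl w") auto
    then show False
      using that assms(1-3) by cases (auto simp: awalk_simps)
  qed
  then show ?thesis
    using gdist_eqI[OF assms(1), of u "[(u, m), (m, v)]" v] assms pair_graphD[OF assms(1)]
    by (simp add: awalk_simps numeral_2_eq_2)
qed

text \<open>By \<open>diam\<close> all distances are 0, 1 or 2, and by \<open>far\<close> every
  eccentricity is 2. The minimum in the definition is thus always 2, and exactly the entries at
  distance 2 survive.\<close>

lemma eccentricity_matrix_radius_two:
  assumes G: "pair_graph G"
    and diam: "\<And>u v. u \<in> pverts G \<Longrightarrow> v \<in> pverts G \<Longrightarrow> u \<noteq> v \<Longrightarrow> (u, v) \<notin> parcs G \<Longrightarrow>
                 \<exists>m. (u, m) \<in> parcs G \<and> (m, v) \<in> parcs G"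
    and far: "\<And>u. u \<in> pverts G \<Longrightarrow> \<exists>v\<in>pverts G. u \<noteq> v \<and> (u, v) \<notin> parcs G"
    and vs: "set vs \<subseteq> pverts G"
  shows "eccentricity_matrix G vs =
    indexed_mat (\<lambda>u v. if u = v \<or> (u, v) \<in> parcs G then 0 else 2) vs vs"
proof -
  have dist: "gdist G u v = (if u = v then 0 else if (u, v) \<in> parcs G then 1 else 2)"
    if "u \<in> pverts G" "v \<in> pverts G" for u v
    using diam[OF that] gdist_self[OF G] gdist_adjacent[OF G] gdist_two[OF G] that by auto
  have ecc: "eccentricity G u = 2" if "u \<in> pverts G" for u
    unfolding eccentricity_def
  proof (rule Max_eqI)
    show "finite (gdist G u ` pverts G)"
      using pair_graph_finite[OF G] by simp
    show "2 \<in> gdist G u ` pverts G"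
      using far[OF that] dist[OF that] by force
    show "y \<le> 2" if "y \<in> gdist G u ` pverts G" for y
      using that dist[OF \<open>u \<in> pverts G\<close>] by auto
  qed
  have mem: "vs ! i \<in> pverts G" if "i < length vs" for i
    using vs that by auto
  show ?thesis
    unfolding eccentricity_matrix_def indexed_mat_def
    by (rule eq_matI) (auto simp: mem ecc dist)
qed

subsection \<open>Regular graphs\<close>

lemma regular_card_neighbours:
  assumes "regular_graph r G" "u \<in> pverts G"
  shows "card {v. (u, v) \<in> parcs G} = r"
proof -
  have "out_arcs (with_proj G) u = Pair u ` {v. (u, v) \<in> parcs G}"
    unfolding out_arcs_def by force
  then have "card (out_arcs (with_proj G) u) = card {v. (u, v) \<in> parcs G}"
    by (simp add: card_image inj_on_def)
  then show ?thesis
    using assms unfolding regular_graph_def out_degree_def by simp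
qed

lemma edge_setE:
  assumes "pair_graph G" "e \<in> edge_set G"
  obtains u v where "e = {u, v}" "(u, v) \<in> parcs G" "u \<in> pverts G" "v \<in> pverts G" "u \<noteq> v"
  using assms pair_graphD[OF assms(1)] unfolding edge_set_def by blast

lemma edges_through_vertex:
  assumes "pair_graph G"
  shows "edge_set G \<inter> {e. u \<in> e} = (\<lambda>v. {u, v}) ` {v. (u, v) \<in> parcs G}"
  using pair_graphD(4)[OF assms] unfolding edge_set_def by (auto simp: insert_commute)

lemma edges_through_two_vertices:
  assumes "pair_graph G" "u \<noteq> v"
  shows "edge_set G \<inter> {e. u \<in> e \<and> v \<in> e} = (if (u, v) \<in> parcs G then {{u, v}} else {})"
  using pair_graphD(4)[OF assms(1)] assms(2) unfolding edge_set_def by auto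

text \<open>Mapping \<open>v\<close> to \<open>{u, v}\<close> is a bijection from the neighbours of
  \<open>u\<close> to the edges through \<open>u\<close>. This transfers the degree, which counts
  arcs, to undirected edges.\<close>

lemma card_edges_through_vertex:
  assumes "pair_graph G" "regular_graph r G" "u \<in> pverts G"
  shows "card (edge_set G \<inter> {e. u \<in> e}) = r"
proof -
  have "inj_on (\<lambda>v. {u, v}) {v. (u, v) \<in> parcs G}"
    by (auto simp: inj_on_def doubleton_eq_iff)
  then show ?thesis
    using regular_card_neighbours[OF assms(2,3)]
    by (simp add: edges_through_vertex[OF assms(1)] card_image)
qed

lemma card_neighbours_in_pverts:
  assumes "pair_graph G" "regular_graph r G" "u \<in> pverts G"
  shows "card (pverts G \<inter> {v. (u, v) \<in> parcs G}) = r"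
proof -
  have "pverts G \<inter> {v. (u, v) \<in> parcs G} = {v. (u, v) \<in> parcs G}"
    using pair_graphD[OF assms(1)] by auto
  then show ?thesis
    using regular_card_neighbours[OF assms(2,3)] by simp
qed

lemma sum_adjacent:
  assumes "pair_graph G" "regular_graph r G" "u \<in> pverts G"
  shows "(\<Sum>v\<in>pverts G. of_bool ((u, v) \<in> parcs G)) = of_nat r"
  using card_neighbours_in_pverts[OF assms] pair_graph_finite[OF assms(1)] by simp

lemma sum_incident_edges:
  assumes "pair_graph G" "regular_graph r G" "u \<in> pverts G"
  shows "(\<Sum>e\<in>edge_set G. of_bool (u \<in> e)) = of_nat r"
  using card_edges_through_vertex[OF assms] finite_edge_set[OF assms(1)]
  by (simp add: sum_of_bool_eq)

lemma card_edge:
  assumes "pair_graph G" "e \<in> edge_set G"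
  shows "card (pverts G \<inter> e) = 2"
proof -
  obtain a b where e: "e = {a, b}" "a \<in> pverts G" "b \<in> pverts G" "a \<noteq> b"
    using edge_setE[OF assms] by metis
  then have "pverts G \<inter> e = {a, b}" by auto
  then show ?thesis using e(4) by simp
qed

text \<open>Entrywise form of \<open>B B\<^sup>T = A + r I\<close> for the incidence matrix: two
  distinct vertices lie on one common edge if adjacent and on none otherwise, and each vertex lies
  on \<open>r\<close> edges.\<close>

lemma sum_common_edges:
  assumes "pair_graph G" "regular_graph r G" "u \<in> pverts G"
  shows "(\<Sum>e\<in>edge_set G. of_bool (u \<in> e) * of_bool (v \<in> e)) =
    of_bool ((u, v) \<in> parcs G) + of_nat r * (of_bool (u = v) :: 'c::comm_semiring_1)"
proof (cases "u = v")
  case True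
  have "(\<Sum>e\<in>edge_set G. of_bool (u \<in> e) * of_bool (u \<in> e) :: 'c) = (\<Sum>e\<in>edge_set G. of_bool (u \<in> e))"
    by (intro sum.cong) auto
  then show ?thesis
    using True sum_incident_edges[OF assms] pair_graphD(3)[OF assms(1)] by auto
next
  case False
  have "(\<Sum>e\<in>edge_set G. of_bool (u \<in> e) * of_bool (v \<in> e) :: 'c) =
      (\<Sum>e\<in>edge_set G. of_bool (u \<in> e \<and> v \<in> e))"
    by (intro sum.cong) auto
  also have "\<dots> = of_bool ((u, v) \<in> parcs G)"
    using finite_edge_set[OF assms(1)] False
    by (simp add: sum_of_bool_eq edges_through_two_vertices[OF assms(1)])
  finally show ?thesis using False by simp
qed

text \<open>Each row of the adjacency matrix has absolute sum \<open>r\<close>, which bounds the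
  modulus of every eigenvalue.\<close>

lemma adjacency_eigenvalue_ge:
  assumes "pair_graph G" "regular_graph r G" "enumerates vs G"
    and "complex_of_real x \<in># eigenvalues (adjacency_matrix G vs)"
  shows "- real r \<le> x"
proof -
  let ?A = "map_mat complex_of_real (adjacency_matrix G vs)"
  have A: "?A \<in> carrier_mat (length vs) (length vs)"
    by (simp add: adjacency_matrix_def)
  have vs: "distinct vs" "set vs = pverts G"
    using assms(3) by (auto simp: enumerates_def)
  have "char_poly ?A \<noteq> 0"
    using degree_monic_char_poly[OF A] by auto
  then have "eigenvalue ?A (complex_of_real x)"
    using assms(4) by (simp add: eigenvalues_def eigenvalue_root_char_poly[OF A])
  moreover have "(\<Sum>j<length vs. norm (?A $$ (i, j))) \<le> real r" if i: "i < length vs" for i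
  proof -
    have "(\<Sum>j<length vs. norm (?A $$ (i, j))) =
        (\<Sum>j = 0..<length vs. of_bool ((vs ! i, vs ! j) \<in> parcs G))"
      unfolding atLeast0LessThan by (intro sum.cong) (use i in \<open>auto simp: adjacency_matrix_def\<close>)
    also have "\<dots> = real r"
      unfolding sum_nth_distinct[OF vs(1), of "\<lambda>v. of_bool ((vs ! i, v) \<in> parcs G)"] vs(2)
      using sum_adjacent[OF assms(1,2)] i vs(2) nth_mem by blast
    finally show ?thesis by simp
  qed
  ultimately have "norm (complex_of_real x) \<le> real r"
    by (rule eigenvalue_norm_le_row_sum[OF A])
  then show ?thesis by simp
qed

subsection \<open>The central edge join\<close>

lemma parcs_central_edge_join:
  "(Inl (Inl u), Inl (Inl v)) \<in> parcs (central_edge_join G\<^sub>1 G\<^sub>2) \<longleftrightarrow>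
     u \<in> pverts G\<^sub>1 \<and> v \<in> pverts G\<^sub>1 \<and> u \<noteq> v \<and> (u, v) \<notin> parcs G\<^sub>1"
  "(Inl (Inl u), Inl (Inr e)) \<in> parcs (central_edge_join G\<^sub>1 G\<^sub>2) \<longleftrightarrow> e \<in> edge_set G\<^sub>1 \<and> u \<in> e"
  "(Inl (Inr e), Inl (Inl u)) \<in> parcs (central_edge_join G\<^sub>1 G\<^sub>2) \<longleftrightarrow> e \<in> edge_set G\<^sub>1 \<and> u \<in> e"
  "(Inl (Inr e), Inl (Inr f)) \<notin> parcs (central_edge_join G\<^sub>1 G\<^sub>2)"
  "(Inl (Inl u), Inr y) \<notin> parcs (central_edge_join G\<^sub>1 G\<^sub>2)"
  "(Inr y, Inl (Inl u)) \<notin> parcs (central_edge_join G\<^sub>1 G\<^sub>2)"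
  "(Inl (Inr e), Inr y) \<in> parcs (central_edge_join G\<^sub>1 G\<^sub>2) \<longleftrightarrow> e \<in> edge_set G\<^sub>1 \<and> y \<in> pverts G\<^sub>2"
  "(Inr y, Inl (Inr e)) \<in> parcs (central_edge_join G\<^sub>1 G\<^sub>2) \<longleftrightarrow> e \<in> edge_set G\<^sub>1 \<and> y \<in> pverts G\<^sub>2"
  "(Inr y, Inr z) \<in> parcs (central_edge_join G\<^sub>1 G\<^sub>2) \<longleftrightarrow> (y, z) \<in> parcs G\<^sub>2"
  unfolding central_edge_join_def central_graph_def by auto

lemma pverts_central_edge_join:
  "pverts (central_edge_join G\<^sub>1 G\<^sub>2) =
     (Inl \<circ> Inl) ` pverts G\<^sub>1 \<union> (Inl \<circ> Inr) ` edge_set G\<^sub>1 \<union> Inr ` pverts G\<^sub>2"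
  unfolding central_edge_join_def central_graph_def by auto

lemma central_edge_join_vertex_cases:
  assumes "x \<in> pverts (central_edge_join G\<^sub>1 G\<^sub>2)"
  obtains (vertex) u where "x = Inl (Inl u)" "u \<in> pverts G\<^sub>1"
    | (edge) e where "x = Inl (Inr e)" "e \<in> edge_set G\<^sub>1"
    | (right) y where "x = Inr y" "y \<in> pverts G\<^sub>2"
  using assms unfolding pverts_central_edge_join by auto

text \<open>Common neighbours of nonadjacent vertices come from the construction: the subdivision
  vertex of an edge for its two ends, any vertex of \<open>G\<^sub>2\<close> for two subdivision
  vertices, any subdivision vertex for two vertices of \<open>G\<^sub>2\<close>, and an incident
  edge for a vertex of \<open>G\<^sub>1\<close> and one of \<open>G\<^sub>2\<close>. Only a vertex
  of \<open>G\<^sub>1\<close> and an edge avoiding it need triangle-freeness.\<close>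

lemma eccentricity_matrix_central_edge_join:
  assumes G: "pair_graph G\<^sub>1" "pair_graph G\<^sub>2" and "triangle_free G\<^sub>1"
    and incident: "\<And>u. u \<in> pverts G\<^sub>1 \<Longrightarrow> \<exists>e\<in>edge_set G\<^sub>1. u \<in> e"
    and other_edge: "\<And>e. e \<in> edge_set G\<^sub>1 \<Longrightarrow> \<exists>f\<in>edge_set G\<^sub>1. f \<noteq> e"
    and ne: "pverts G\<^sub>1 \<noteq> {}" "pverts G\<^sub>2 \<noteq> {}"
    and vs: "set vs \<subseteq> pverts (central_edge_join G\<^sub>1 G\<^sub>2)"
  shows "eccentricity_matrix (central_edge_join G\<^sub>1 G\<^sub>2) vs =
    indexed_mat (\<lambda>x y. if x = y \<or> (x, y) \<in> parcs (central_edge_join G\<^sub>1 G\<^sub>2) then 0 else 2) vs vs"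
proof (rule eccentricity_matrix_radius_two[OF pair_graph_central_edge_join[OF G] _ _ vs])
  let ?H = "central_edge_join G\<^sub>1 G\<^sub>2"
  let ?adj = "\<lambda>x y. (x, y) \<in> parcs ?H"
  note adj = parcs_central_edge_join
  \<comment> \<open>Here \<open>b\<close> serves as common neighbour of two subdivision vertices and
    as a vertex not adjacent to any vertex of \<open>G\<^sub>1\<close>; \<open>a\<close> is a vertex
    not adjacent to any vertex of \<open>G\<^sub>2\<close>.\<close>
  obtain a b where ab: "a \<in> pverts G\<^sub>1" "b \<in> pverts G\<^sub>2"
    using ne by blast
  have vert: "u \<in> pverts G\<^sub>1" if "e \<in> edge_set G\<^sub>1" "u \<in> e" for u e
    using edge_setE[OF G(1) that(1)] that(2) by blast
  \<comment> \<open>Distinct vertices of \<open>G\<^sub>1\<close> that are nonadjacent in the join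
    are adjacent in \<open>G\<^sub>1\<close>, so their edge has a subdivision vertex.\<close>
  have VV: "\<exists>m. ?adj (Inl (Inl u)) m \<and> ?adj m (Inl (Inl v))"
    if "u \<in> pverts G\<^sub>1" "v \<in> pverts G\<^sub>1" "u \<noteq> v" "\<not> ?adj (Inl (Inl u)) (Inl (Inl v))" for u v
  proof (intro exI conjI)
    have "{u, v} \<in> edge_set G\<^sub>1"
      using that unfolding adj edge_set_def by auto
    then show "?adj (Inl (Inl u)) (Inl (Inr {u, v}))" "?adj (Inl (Inr {u, v})) (Inl (Inl v))"
      unfolding adj by auto
  qed
  \<comment> \<open>Triangle-freeness: a vertex outside an edge misses one of its endpoints.\<close>
  have VE: "\<exists>w. ?adj (Inl (Inl u)) (Inl (Inl w)) \<and> ?adj (Inl (Inl w)) (Inl (Inr e))"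
    if ue: "u \<in> pverts G\<^sub>1" "e \<in> edge_set G\<^sub>1" "u \<notin> e" for u e
  proof -
    obtain c d where e: "e = {c, d}" "(c, d) \<in> parcs G\<^sub>1"
      using edge_setE[OF G(1) ue(2)] by metis
    have "(u, c) \<notin> parcs G\<^sub>1 \<or> (u, d) \<notin> parcs G\<^sub>1"
      using \<open>triangle_free G\<^sub>1\<close> e(2) pair_graphD(4)[OF G(1)] unfolding triangle_free_def by blast
    then obtain w where "w \<in> e" "(u, w) \<notin> parcs G\<^sub>1"
      using e(1) by blast
    then show ?thesis
      using ue vert[OF ue(2)] unfolding adj by blast
  qed
  have sym: "?adj y x" if "?adj x y" for x y
    using pair_graphD(4)[OF pair_graph_central_edge_join[OF G] that] .
  have VY: "\<exists>e. ?adj (Inl (Inl u)) (Inl (Inr e)) \<and> ?adj (Inl (Inr e)) (Inr y)"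
    if "u \<in> pverts G\<^sub>1" "y \<in> pverts G\<^sub>2" for u y
    using incident[OF that(1)] that unfolding adj by blast
  show "\<exists>m. ?adj x m \<and> ?adj m y"
    if xy: "x \<in> pverts ?H" "y \<in> pverts ?H" "x \<noteq> y" "\<not> ?adj x y" for x y
  proof -
    show ?thesis
    proof (cases rule: central_edge_join_vertex_cases[OF xy(1), case_names vertex edge right])
      case (vertex u)
      show ?thesis
      proof (cases rule: central_edge_join_vertex_cases[OF xy(2), case_names vertex' edge' right'])
        case (vertex' v)
        then show ?thesis using VV vertex xy(3,4) by simp
      next
        case (edge' e)
        with vertex xy(4) have "u \<notin> e" by (simp add: adj)
        from VE[OF vertex(2) edge'(2) this] show ?thesis
          unfolding vertex(1) edge'(1) by blast
      next
        case (right' z)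
        from VY[OF vertex(2) right'(2)] show ?thesis
          unfolding vertex(1) right'(1) by blast
      qed
    next
      case (edge e)
      show ?thesis
      proof (cases rule: central_edge_join_vertex_cases[OF xy(2), case_names vertex' edge' right'])
        case (vertex' v)
        with edge xy(4) have "v \<notin> e" by (simp add: adj)
        from VE[OF vertex'(2) edge(2) this] show ?thesis
          unfolding vertex'(1) edge(1) using sym by blast
      next
        case (edge' f)
        then show ?thesis
          using edge ab by (auto simp: adj intro!: exI[of _ "Inr b"])
      next
        case (right' z)
        then show ?thesis using edge xy(4) by (simp add: adj)
      qed
    next
      case (right z)
      show ?thesis
      proof (cases rule: central_edge_join_vertex_cases[OF xy(2), case_names vertex' edge' right'])
        case (vertex' v)
        from VY[OF vertex'(2) right(2)] show ?thesis
          unfolding vertex'(1) right(1) using sym by blast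
      next
        case (edge' e)
        then show ?thesis using right xy(4) by (simp add: adj)
      next
        case (right' z')
        obtain e where "e \<in> edge_set G\<^sub>1" using incident[OF ab(1)] by blast
        then show ?thesis
          using right right' by (auto simp: adj intro!: exI[of _ "Inl (Inr e)"])
      qed
    qed
  qed
  show "\<exists>y\<in>pverts ?H. x \<noteq> y \<and> (x, y) \<notin> parcs ?H" if x: "x \<in> pverts ?H" for x
  proof -
    have in_H: "Inl (Inl a) \<in> pverts ?H" "Inr b \<in> pverts ?H"
      "\<And>f. f \<in> edge_set G\<^sub>1 \<Longrightarrow> Inl (Inr f) \<in> pverts ?H"
      using ab unfolding pverts_central_edge_join by auto
    show ?thesis
    proof (cases rule: central_edge_join_vertex_cases[OF x, case_names vertex edge right])
      case (vertex u)
      then show ?thesis using in_H(2) by (intro bexI[of _ "Inr b"]) (simp_all add: adj)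
    next
      case (edge e)
      then obtain f where "f \<in> edge_set G\<^sub>1" "f \<noteq> e" using other_edge by blast
      with edge in_H(3) show ?thesis by (intro bexI[of _ "Inl (Inr f)"]) (simp_all add: adj)
    next
      case (right y)
      then show ?thesis using in_H(1) by (intro bexI[of _ "Inl (Inl a)"]) (simp_all add: adj)
    qed
  qed
qed

theorem theorem3p13:
  fixes G\<^sub>1 :: "'a pair_pre_digraph" and G\<^sub>2 :: "'b pair_pre_digraph"
    and r\<^sub>1 r\<^sub>2 p\<^sub>1 p\<^sub>2 q\<^sub>1 q\<^sub>2 :: nat
    and lam \<beta> :: "nat \<Rightarrow> real"
    and vs\<^sub>1 :: "'a list" and vs\<^sub>2 :: "'b list" and vs :: "(('a + 'a set) + 'b) list"
  assumes "connected_graph G\<^sub>1" and "connected_graph G\<^sub>2"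
    and "regular_graph r\<^sub>1 G\<^sub>1" and "regular_graph r\<^sub>2 G\<^sub>2"
    and "card (pverts G\<^sub>1) = p\<^sub>1" and "card (pverts G\<^sub>2) = p\<^sub>2"
    and "card (edge_set G\<^sub>1) = q\<^sub>1" and "card (edge_set G\<^sub>2) = q\<^sub>2"
    and "triangle_free G\<^sub>1"
    and "p\<^sub>1 \<le> q\<^sub>1"
    and "enumerates vs\<^sub>1 G\<^sub>1" and "enumerates vs\<^sub>2 G\<^sub>2"
    and "enumerates vs (central_edge_join G\<^sub>1 G\<^sub>2)"
    and "eigenvalues (adjacency_matrix G\<^sub>1 vs\<^sub>1)
           = image_mset complex_of_real ({#real r\<^sub>1#} + {#lam i. i \<in># mset_set {2..p\<^sub>1}#})"
    and "eigenvalues (adjacency_matrix G\<^sub>2 vs\<^sub>2)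
           = image_mset complex_of_real ({#real r\<^sub>2#} + {#\<beta> j. j \<in># mset_set {2..p\<^sub>2}#})"
  shows "eigenvalues (eccentricity_matrix (central_edge_join G\<^sub>1 G\<^sub>2) vs)
     = image_mset complex_of_real
         (replicate_mset (q\<^sub>1 - p\<^sub>1) (-2)
          + {#-2 * (1 + \<beta> j). j \<in># mset_set {2..p\<^sub>2}#}
          + {#(lam i - 1) + sqrt ((lam i + 1)^2 + 4 * (lam i + real r\<^sub>1)). i \<in># mset_set {2..p\<^sub>1}#}
          + {#(lam i - 1) - sqrt ((lam i + 1)^2 + 4 * (lam i + real r\<^sub>1)). i \<in># mset_set {2..p\<^sub>1}#})
       + eigenvalues (mat_of_rows_list 3
           [[2 * real r\<^sub>1, 2 * (real q\<^sub>1 - real r\<^sub>1), 2 * real p\<^sub>2],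
            [2 * (real p\<^sub>1 - 2), 2 * (real q\<^sub>1 - 1), 0],
            [2 * real p\<^sub>1, 0, 2 * (real p\<^sub>2 - 1 - real r\<^sub>2)]])"
    (is "_ = image_mset _ ?M + eigenvalues ?Q")
proof -

  \<comment> \<open>Setup and counting in \<open>G\<^sub>1\<close>\<close>
  note reg = assms(3,4)
  have G: "pair_graph G\<^sub>1" "pair_graph G\<^sub>2"
    using assms(1,2) by auto
  \<comment> \<open>Connectedness includes having at least one vertex.\<close>
  have ne: "pverts G\<^sub>1 \<noteq> {}" "pverts G\<^sub>2 \<noteq> {}"
    using assms(1,2)
    by (auto simp: Digraph_Component.connected_def strongly_connected_def mk_symmetric_def)
  note fin = pair_graph_finite[OF G(1)] pair_graph_finite[OF G(2)] finite_edge_set[OF G(1)]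
  have vs1: "distinct vs\<^sub>1" "set vs\<^sub>1 = pverts G\<^sub>1" and vs2: "distinct vs\<^sub>2" "set vs\<^sub>2 = pverts G\<^sub>2"
    using assms(11,12) by (auto simp: enumerates_def)
  obtain es where es: "distinct es" "set es = edge_set G\<^sub>1"
    using finite_distinct_list[OF fin(3)] by blast
  have len: "length vs\<^sub>1 = p\<^sub>1" "length es = q\<^sub>1" "length vs\<^sub>2 = p\<^sub>2"
    using distinct_card[OF vs1(1)] distinct_card[OF vs2(1)] distinct_card[OF es(1)]
      vs1 vs2 es assms(5-7) by simp_all

  \<comment> \<open>Since \<open>p\<^sub>1 \<le> q\<^sub>1\<close>, a vertex forces an edge, an edge
    forces two vertices, and these force two edges. This excludes the one-vertex graph and the
    single edge, where the eccentricities would not all be 2.\<close>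
  have "0 < p\<^sub>1"
    using ne(1) fin(1) assms(5) by (auto simp: card_gt_0_iff)
  then have "edge_set G\<^sub>1 \<noteq> {}"
    using assms(7,10) by auto
  then obtain a b where ab: "(a, b) \<in> parcs G\<^sub>1" "a \<in> pverts G\<^sub>1" "b \<in> pverts G\<^sub>1" "a \<noteq> b"
    using edge_setE[OF G(1)] by blast
  have "card {a, b} \<le> p\<^sub>1"
    unfolding assms(5)[symmetric] by (rule card_mono) (use ab fin in auto)
  then have q2: "2 \<le> q\<^sub>1"
    using assms(10) ab(4) by simp
  have "finite {v. (a, v) \<in> parcs G\<^sub>1}"
    by (rule finite_subset[OF _ fin(1)]) (use pair_graphD[OF G(1)] in auto)
  then have "card {v. (a, v) \<in> parcs G\<^sub>1} \<noteq> 0"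
    using ab(1) by (subst card_0_eq) blast+
  then have r1: "r\<^sub>1 \<noteq> 0"
    using regular_card_neighbours[OF reg(1) ab(2)] by simp
  have incident: "\<exists>e\<in>edge_set G\<^sub>1. u \<in> e" if "u \<in> pverts G\<^sub>1" for u
  proof -
    have "edge_set G\<^sub>1 \<inter> {e. u \<in> e} \<noteq> {}"
      using card_edges_through_vertex[OF G(1) reg(1) that] r1 by force
    then show ?thesis by blast
  qed
  have other_edge: "\<exists>f\<in>edge_set G\<^sub>1. f \<noteq> e" if "e \<in> edge_set G\<^sub>1" for e
  proof (rule ccontr)
    assume "\<not> ?thesis"
    then have "edge_set G\<^sub>1 \<subseteq> {e}" by blast
    then have "card (edge_set G\<^sub>1) \<le> card {e}" by (rule card_mono[rotated]) simp
    then show False using q2 assms(7) by simp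
  qed

  \<comment> \<open>The eccentricity matrix split along the three parts\<close>
  let ?H = "central_edge_join G\<^sub>1 G\<^sub>2"
  have vs: "distinct vs" "set vs = pverts ?H"
    using assms(13) by (auto simp: enumerates_def)
  have ecc: "eccentricity_matrix ?H xs =
      indexed_mat (\<lambda>x y. if x = y \<or> (x, y) \<in> parcs ?H then 0 else 2) xs xs"
    if "set xs = pverts ?H" for xs
    using eccentricity_matrix_central_edge_join[OF G assms(9), of xs] incident other_edge ne that by simp
  \<comment> \<open>This ordering lists the three parts one after the other; the given
    \<open>vs\<close> is recovered by reordering.\<close>
  define vs' :: "(('a + 'a set) + 'b) list" where
    "vs' = (map (Inl \<circ> Inl) vs\<^sub>1 @ map (Inl \<circ> Inr) es) @ map Inr vs\<^sub>2"
  define E :: "('a + 'a set) + 'b \<Rightarrow> ('a + 'a set) + 'b \<Rightarrow> complex" where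
    "E x y = (if x = y \<or> (x, y) \<in> parcs ?H then 0 else 2)" for x y
  define cls :: "('a + 'a set) + 'b \<Rightarrow> nat" where
    "cls = case_sum (case_sum (\<lambda>_. 0) (\<lambda>_. 1)) (\<lambda>_. 2)"
  \<comment> \<open>\<open>K k l\<close> is the default entry between parts \<open>k\<close> and
    \<open>l\<close>, and \<open>N\<close> is the deviation from it. The default is 0 within the
    vertices of \<open>G\<^sub>1\<close>, where nonadjacency is the exception, and between
    subdivision vertices and \<open>G\<^sub>2\<close>, which are completely joined.\<close>
  define K :: "nat \<Rightarrow> nat \<Rightarrow> complex" where
    "K k l = (if k = 0 \<and> l = 0 \<or> {k, l} = {1, 2} then 0 else 2)" for k l
  define N where "N x y = E x y - K (cls x) (cls y)" for x y
  \<comment> \<open>\<open>q k l\<close> is the sum of a row of \<open>N\<close> from part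
    \<open>k\<close> over the columns of part \<open>l\<close>; the entry \<open>- 4\<close>
    reflects the two ends of an edge.\<close>
  define q :: "nat \<Rightarrow> nat \<Rightarrow> complex" where
    "q k l = [[2 * r\<^sub>1, - 2 * of_nat r\<^sub>1, 0], [- 4, - 2, 0], [0, 0, - 2 - 2 * of_nat r\<^sub>2]] ! k ! l" for k l

  have vs': "distinct vs'" "set vs' = pverts ?H"
    unfolding vs'_def pverts_central_edge_join using vs1 vs2 es
    by (auto simp: distinct_map inj_on_def)
  have cls_simps [simp]: "cls (Inl (Inl u)) = 0" "cls (Inl (Inr e)) = 1" "cls (Inr y) = 2" for u e y
    by (simp_all add: cls_def)
  have sum_vs': "(\<Sum>x\<in>set vs'. g x) = (\<Sum>u\<in>pverts G\<^sub>1. g (Inl (Inl u))) +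
      (\<Sum>e\<in>edge_set G\<^sub>1. g (Inl (Inr e))) + (\<Sum>y\<in>pverts G\<^sub>2. g (Inr y))"
    for g :: "('a + 'a set) + 'b \<Rightarrow> complex"
  proof -
    have "(\<Sum>x\<in>set vs'. g x) = sum_list (map g vs')"
      by (rule sum.distinct_set_conv_list[OF vs'(1)])
    then show ?thesis
      using vs1 vs2 es by (simp add: vs'_def comp_def flip: sum.distinct_set_conv_list)
  qed
  have K_simps [simp]: "K 0 0 = 0" "K 0 1 = 2" "K 0 2 = 2" "K 1 0 = 2" "K 1 1 = 2" "K 1 2 = 0"
    "K 2 0 = 2" "K 2 1 = 0" "K 2 2 = 2" "K 0 (Suc 0) = 2" "K (Suc 0) 0 = 2" "K (Suc 0) (Suc 0) = 2"
    "K (Suc 0) 2 = 0" "K 2 (Suc 0) = 0"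
    by (auto simp: K_def doubleton_eq_iff)
  have q_simps [simp]: "q 0 0 = 2 * r\<^sub>1" "q 0 1 = - 2 * r\<^sub>1" "q 0 2 = 0" "q 1 0 = - 4" "q 1 1 = - 2"
    "q 1 2 = 0" "q 2 0 = 0" "q 2 1 = 0" "q 2 2 = - 2 - 2 * r\<^sub>2"
    "q 0 (Suc 0) = - 2 * r\<^sub>1" "q (Suc 0) 0 = - 4" "q (Suc 0) (Suc 0) = - 2" "q (Suc 0) 2 = 0" "q 2 (Suc 0) = 0"
    by (simp_all add: q_def)
  have N_simps:
    "\<And>u v. u \<in> pverts G\<^sub>1 \<Longrightarrow> v \<in> pverts G\<^sub>1 \<Longrightarrow>
      N (Inl (Inl u)) (Inl (Inl v)) = 2 * of_bool ((u, v) \<in> parcs G\<^sub>1)"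
    "\<And>u e. e \<in> edge_set G\<^sub>1 \<Longrightarrow> N (Inl (Inl u)) (Inl (Inr e)) = - 2 * of_bool (u \<in> e)"
    "\<And>e u. e \<in> edge_set G\<^sub>1 \<Longrightarrow> N (Inl (Inr e)) (Inl (Inl u)) = - 2 * of_bool (u \<in> e)"
    "\<And>e f. N (Inl (Inr e)) (Inl (Inr f)) = - 2 * of_bool (e = f)"
    "\<And>u y. N (Inl (Inl u)) (Inr y) = 0"
    "\<And>y u. N (Inr y) (Inl (Inl u)) = 0"
    "\<And>e y. e \<in> edge_set G\<^sub>1 \<Longrightarrow> y \<in> pverts G\<^sub>2 \<Longrightarrow> N (Inl (Inr e)) (Inr y) = 0"
    "\<And>y e. e \<in> edge_set G\<^sub>1 \<Longrightarrow> y \<in> pverts G\<^sub>2 \<Longrightarrow> N (Inr y) (Inl (Inr e)) = 0"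
    "\<And>y z. N (Inr y) (Inr z) = - 2 * of_bool (y = z) + - 2 * of_bool ((y, z) \<in> parcs G\<^sub>2)"
    using pair_graphD(3)[OF G(1)] pair_graphD(3)[OF G(2)]
    unfolding N_def E_def by (auto simp: parcs_central_edge_join)

  define U where "U = indexed_mat (\<lambda>x k. of_bool (cls x = k) :: complex) vs' [0, 1, 2]"
  define W where "W = indexed_mat (\<lambda>k y. K k (cls y)) [0, 1, 2] vs'"
  define Q where "Q = indexed_mat q [0, 1, 2] [0, 1, 2]"
  define N' where "N' = indexed_mat N vs' vs'"

  \<comment> \<open>Passing to the quotient by the three parts\<close>
  have "char_poly (N' + U * W) * char_poly Q = char_poly N' * char_poly (Q + W * U)"
  proof (rule char_poly_equitable_update)
    show "N' \<in> carrier_mat (length vs') (length vs')" "U \<in> carrier_mat (length vs') 3"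
      "W \<in> carrier_mat 3 (length vs')" "Q \<in> carrier_mat 3 3"
      unfolding N'_def U_def W_def Q_def indexed_mat_def by auto
    have delta: "(\<Sum>y\<in>S. of_bool (x = y)) = (1 :: complex)" if "finite S" "x \<in> S" for S and x :: 'x
      using that by (simp add: of_bool_def)
    \<comment> \<open>Entrywise form of \<open>N' U = U Q\<close>: row sums over a part depend only
      on the part of the row, by regularity of both graphs and because every edge has two
      ends.\<close>
    have "(\<Sum>y\<in>set vs'. N x y * of_bool (cls y = l)) = (\<Sum>k\<in>{0, 1, 2}. of_bool (cls x = k) * q k l)"
      if x: "x \<in> set vs'" and l: "l \<in> {0, 1, 2}" for x l
    proof -
      show ?thesis
      proof (cases rule: central_edge_join_vertex_cases[OF x[unfolded vs'(2)], case_names vertex edge right])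
        case (vertex u)
        then show ?thesis
          using l by (auto simp: sum_vs' N_simps sum_adjacent[OF G(1) reg(1)]
              sum_incident_edges[OF G(1) reg(1)] sum_negf simp flip: sum_distrib_left)
      next
        case (edge e)
        then show ?thesis
          using l by (auto simp: sum_vs' N_simps card_edge[OF G(1)] fin delta sum_negf
              simp flip: sum_distrib_left)
      next
        case (right y)
        then show ?thesis
          using l by (auto simp: sum_vs' N_simps card_neighbours_in_pverts[OF G(2) reg(2)] fin delta
              sum_negf sum.distrib
              sum_subtractf
              simp flip: sum_distrib_left)
      qed
    qed
    then show "N' * U = U * Q"
      unfolding N'_def U_def Q_def indexed_mat_mult[OF vs'(1)]
      by (subst indexed_mat_mult) (auto intro!: indexed_mat_cong)
  qed
  also have "N' + U * W = map_mat complex_of_real (eccentricity_matrix ?H vs')"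
  proof -
    have "N x y + (\<Sum>k\<in>{0, 1, 2}. of_bool (cls x = k) * K k (cls y)) =
        complex_of_real (if x = y \<or> (x, y) \<in> parcs ?H then 0 else 2)" for x y
    proof -
      have "cls x \<in> {0, 1, 2}"
        by (auto simp: cls_def split: sum.splits)
      then have "(\<Sum>k\<in>{0, 1, 2}. of_bool (cls x = k) * K k (cls y)) = K (cls x) (cls y)"
        by auto
      then show ?thesis by (simp add: N_def E_def)
    qed
    then show ?thesis
      unfolding N'_def U_def W_def ecc[OF vs'(2)] map_mat_indexed_mat
      by (subst indexed_mat_mult) (auto simp: indexed_mat_add)
  qed
  also have "char_poly \<dots> = char_poly (map_mat complex_of_real (eccentricity_matrix ?H vs))"
    unfolding ecc[OF vs'(2)] ecc[OF vs(2)]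
      map_mat_indexed_mat
    by (rule char_poly_indexed_mat_reorder) (use vs vs' in auto)
  also have "Q + W * U = map_mat complex_of_real ?Q"
  proof -
    have WU: "W * U =
        indexed_mat (\<lambda>k l. \<Sum>y\<in>set vs'. K k (cls y) * of_bool (cls y = l)) [0, 1, 2] [0, 1, 2]"
      unfolding W_def U_def by (rule indexed_mat_mult[OF vs'(1)])
    \<comment> \<open>The entry of \<open>W U\<close> is \<open>K k l\<close> times the size of part
      \<open>l\<close>, one of \<open>p\<^sub>1\<close>, \<open>q\<^sub>1\<close>,
      \<open>p\<^sub>2\<close>.\<close>
    have "q k l + (\<Sum>y\<in>set vs'. K k (cls y) * of_bool (cls y = l)) =
        [[2 * of_nat r\<^sub>1, 2 * (of_nat q\<^sub>1 - of_nat r\<^sub>1), 2 * of_nat p\<^sub>2],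
         [2 * (of_nat p\<^sub>1 - 2), 2 * (of_nat q\<^sub>1 - 1), 0],
         [2 * of_nat p\<^sub>1, 0, 2 * (of_nat p\<^sub>2 - 1 - of_nat r\<^sub>2)]] ! k ! l"
      if "k \<in> set [0, 1, 2]" "l \<in> set [0, 1, 2]" for k l
      using that by (auto simp: sum_vs' assms(5-7) algebra_simps)
    then have "Q + W * U = indexed_mat (\<lambda>k l.
        [[2 * of_nat r\<^sub>1, 2 * (of_nat q\<^sub>1 - of_nat r\<^sub>1), 2 * of_nat p\<^sub>2],
         [2 * (of_nat p\<^sub>1 - 2), 2 * (of_nat q\<^sub>1 - 1), 0],
         [2 * of_nat p\<^sub>1, 0, 2 * (of_nat p\<^sub>2 - 1 - of_nat r\<^sub>2)]] ! k ! l) [0, 1, 2] [0, 1, 2]"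
      unfolding WU Q_def indexed_mat_add by (rule indexed_mat_cong)
    also have "\<dots> = map_mat complex_of_real ?Q"
      by (rule eq_matI) (auto simp: indexed_mat_def mat_of_rows_list_def less_Suc_eq numeral_3_eq_3)
    finally show ?thesis .
  qed
  finally have main: "char_poly (map_mat complex_of_real (eccentricity_matrix ?H vs)) * char_poly Q =
    char_poly N' * char_poly (map_mat complex_of_real ?Q)" .

  \<comment> \<open>The characteristic polynomials of \<open>N'\<close> and \<open>Q\<close>\<close>
  define A\<^sub>1 where "A\<^sub>1 = indexed_mat (\<lambda>u v. of_bool ((u, v) \<in> parcs G\<^sub>1) :: complex) vs\<^sub>1 vs\<^sub>1"
  define A\<^sub>2 where "A\<^sub>2 = indexed_mat (\<lambda>u v. of_bool ((u, v) \<in> parcs G\<^sub>2) :: complex) vs\<^sub>2 vs\<^sub>2"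
  define B where "B = indexed_mat (\<lambda>u e. of_bool (u \<in> e) :: complex) vs\<^sub>1 es"
  define M\<^sub>1 where "M\<^sub>1 = image_mset complex_of_real {#lam i. i \<in># mset_set {2..p\<^sub>1}#}"
  define M\<^sub>2 where "M\<^sub>2 = image_mset complex_of_real {#\<beta> j. j \<in># mset_set {2..p\<^sub>2}#}"
  have carr: "A\<^sub>1 \<in> carrier_mat p\<^sub>1 p\<^sub>1" "A\<^sub>2 \<in> carrier_mat p\<^sub>2 p\<^sub>2" "B \<in> carrier_mat p\<^sub>1 q\<^sub>1"
    unfolding A\<^sub>1_def A\<^sub>2_def B_def len[symmetric] by simp_all
  have "map_mat complex_of_real (adjacency_matrix G\<^sub>1 vs\<^sub>1) = A\<^sub>1"
    "map_mat complex_of_real (adjacency_matrix G\<^sub>2 vs\<^sub>2) = A\<^sub>2"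
    unfolding A\<^sub>1_def A\<^sub>2_def adjacency_matrix_def indexed_mat_def by (auto intro!: eq_matI)
  with assms(14,15) have "proots (char_poly A\<^sub>1) = add_mset (of_nat r\<^sub>1) M\<^sub>1"
    "proots (char_poly A\<^sub>2) = add_mset (of_nat r\<^sub>2) M\<^sub>2"
    by (simp_all add: eigenvalues_def M\<^sub>1_def M\<^sub>2_def)
  then have A1: "char_poly A\<^sub>1 = (\<Prod>x\<in>#add_mset (of_nat r\<^sub>1) M\<^sub>1. [:- x, 1:])"
    and A2: "char_poly A\<^sub>2 = (\<Prod>x\<in>#add_mset (of_nat r\<^sub>2) M\<^sub>2. [:- x, 1:])"
    using char_poly_eq_prod_proots[OF carr(1)] char_poly_eq_prod_proots[OF carr(2)] by simp_all
  have BB: "B * B\<^sup>T = A\<^sub>1 + of_nat r\<^sub>1 \<cdot>\<^sub>m 1\<^sub>m p\<^sub>1"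
  proof -
    have one: "of_nat r\<^sub>1 \<cdot>\<^sub>m 1\<^sub>m p\<^sub>1 =
        indexed_mat (\<lambda>u v. of_nat r\<^sub>1 * of_bool (u = v) :: complex) vs\<^sub>1 vs\<^sub>1"
      unfolding len(1)[symmetric] one_indexed_mat[OF vs1(1), symmetric]
      by (rule eq_matI) (auto simp: indexed_mat_def)
    show ?thesis
      unfolding A\<^sub>1_def B_def one indexed_mat_add transpose_indexed_mat indexed_mat_mult[OF es(1)]
      by (rule indexed_mat_cong) (simp add: es(2) vs1(2) sum_common_edges[OF G(1) reg(1)])
  qed

  let ?L = "[:2, 1:] :: complex poly"
  \<comment> \<open>The quadratic factor that an eigenvalue \<open>x\<close> of
    \<open>A\<^sub>1\<close> contributes to the characteristic polynomial of
    \<open>N\<^sub>1\<close>.\<close>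
  define F where "F x = [:- 2 * x, 1:] * ?L - [:4 * (x + of_nat r\<^sub>1):]" for x
  define N\<^sub>1 where "N\<^sub>1 = four_block_mat (2 \<cdot>\<^sub>m A\<^sub>1) (- 2 \<cdot>\<^sub>m B) (- 2 \<cdot>\<^sub>m B\<^sup>T) (- 2 \<cdot>\<^sub>m 1\<^sub>m q\<^sub>1)"
  define N\<^sub>2 where "N\<^sub>2 = (- 2) \<cdot>\<^sub>m 1\<^sub>m p\<^sub>2 + (- 2) \<cdot>\<^sub>m A\<^sub>2"
  have N1: "indexed_mat N (map (Inl \<circ> Inl) vs\<^sub>1 @ map (Inl \<circ> Inr) es)
      (map (Inl \<circ> Inl) vs\<^sub>1 @ map (Inl \<circ> Inr) es) = N\<^sub>1"
    unfolding N\<^sub>1_def indexed_mat_append indexed_mat_map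
  proof (rule cong_four_block_mat)
    show "indexed_mat (\<lambda>u v. N ((Inl \<circ> Inl) u) ((Inl \<circ> Inl) v)) vs\<^sub>1 vs\<^sub>1 = 2 \<cdot>\<^sub>m A\<^sub>1"
      "indexed_mat (\<lambda>u e. N ((Inl \<circ> Inl) u) ((Inl \<circ> Inr) e)) vs\<^sub>1 es = - 2 \<cdot>\<^sub>m B"
      "indexed_mat (\<lambda>e u. N ((Inl \<circ> Inr) e) ((Inl \<circ> Inl) u)) es vs\<^sub>1 = - 2 \<cdot>\<^sub>m B\<^sup>T"
      "indexed_mat (\<lambda>e f. N ((Inl \<circ> Inr) e) ((Inl \<circ> Inr) f)) es es = - 2 \<cdot>\<^sub>m 1\<^sub>m q\<^sub>1"
      unfolding A\<^sub>1_def B_def transpose_indexed_mat len(2)[symmetric] one_indexed_mat[OF es(1), symmetric]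
        indexed_mat_smult
      by (rule indexed_mat_cong; use vs1 es in \<open>simp add: N_simps\<close>)+
  qed
  have N2: "indexed_mat N (map Inr vs\<^sub>2) (map Inr vs\<^sub>2) = N\<^sub>2"
    unfolding N\<^sub>2_def A\<^sub>2_def indexed_mat_map len(3)[symmetric] one_indexed_mat[OF vs2(1), symmetric]
      indexed_mat_smult indexed_mat_add
    by (rule indexed_mat_cong) (use vs2 in \<open>simp add: N_simps\<close>)
  have N': "N' = four_block_mat N\<^sub>1 (0\<^sub>m (p\<^sub>1 + q\<^sub>1) p\<^sub>2) (0\<^sub>m p\<^sub>2 (p\<^sub>1 + q\<^sub>1)) N\<^sub>2"
  proof -
    let ?xs = "map (Inl \<circ> Inl) vs\<^sub>1 @ map (Inl \<circ> Inr) es :: (('a + 'a set) + 'b) list"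
      and ?ys = "map Inr vs\<^sub>2 :: (('a + 'a set) + 'b) list"
    have "indexed_mat N ?xs ?ys = indexed_mat (\<lambda>_ _. 0) ?xs ?ys"
      by (rule indexed_mat_cong) (use vs1 vs2 es in \<open>auto simp: N_simps\<close>)
    moreover have "indexed_mat N ?ys ?xs = indexed_mat (\<lambda>_ _. 0) ?ys ?xs"
      by (rule indexed_mat_cong) (use vs1 vs2 es in \<open>auto simp: N_simps\<close>)
    ultimately show ?thesis
      unfolding N'_def vs'_def by (subst indexed_mat_append) (simp add: N1 N2 zero_indexed_mat len)
  qed
  have "N\<^sub>1 \<in> carrier_mat (p\<^sub>1 + q\<^sub>1) (p\<^sub>1 + q\<^sub>1)" "N\<^sub>2 \<in> carrier_mat p\<^sub>2 p\<^sub>2"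
    unfolding N\<^sub>1_def N\<^sub>2_def using carr by auto
  then have cN: "char_poly N' = char_poly N\<^sub>1 * char_poly N\<^sub>2"
    unfolding N' by (intro char_poly_four_block_upper_right_zero) auto
  have "char_poly N\<^sub>1 * ?L ^ p\<^sub>1 = (\<Prod>x\<in>#add_mset (of_nat r\<^sub>1) M\<^sub>1. F x) * ?L ^ q\<^sub>1"
    unfolding N\<^sub>1_def F_def by (rule char_poly_incidence_block[OF carr(1,3) BB A1])
  \<comment> \<open>By \<open>p\<^sub>1 \<le> q\<^sub>1\<close> the power splits. Cancelling
    \<open>?L ^ p\<^sub>1\<close> leaves the exponent that becomes the multiplicity of -2.\<close>
  also have "?L ^ q\<^sub>1 = ?L ^ (q\<^sub>1 - p\<^sub>1) * ?L ^ p\<^sub>1"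
    using assms(10) by (simp flip: power_add)
  finally have "char_poly N\<^sub>1 * ?L ^ p\<^sub>1 =
      ((\<Prod>x\<in>#add_mset (of_nat r\<^sub>1) M\<^sub>1. F x) * ?L ^ (q\<^sub>1 - p\<^sub>1)) * ?L ^ p\<^sub>1"
    by (simp only: mult.assoc)
  then have cN1: "char_poly N\<^sub>1 = F (of_nat r\<^sub>1) * ((\<Prod>x\<in>#M\<^sub>1. F x) * ?L ^ (q\<^sub>1 - p\<^sub>1))"
    by (subst (asm) mult_right_cancel) (simp_all add: mult.assoc del: mult_pCons_left mult_pCons_right)
  have cN2: "char_poly N\<^sub>2 = [:2 + 2 * of_nat r\<^sub>2, 1:] * (\<Prod>x\<in>#M\<^sub>2. [:2 + 2 * x, 1:])"
    unfolding N\<^sub>2_def char_poly_affine[OF carr(2) A2] by (simp add: add.commute del: mult_pCons_left)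
  \<comment> \<open>\<open>Q\<close> is block diagonal, with a 2 by 2 corner belonging to
    \<open>G\<^sub>1\<close>. Its two factors are those of \<open>r\<^sub>1\<close> and
    \<open>r\<^sub>2\<close> in \<open>cN1\<close> and \<open>cN2\<close>.\<close>
  have cQ: "char_poly Q = F (of_nat r\<^sub>1) * [:2 + 2 * of_nat r\<^sub>2, 1:]"
  proof -
    have "Q = indexed_mat q ([0, 1] @ [2]) ([0, 1] @ [2])"
      by (simp add: Q_def)
    also have "\<dots> =
        four_block_mat (indexed_mat q [0, 1] [0, 1]) (0\<^sub>m 2 1) (0\<^sub>m 1 2) (indexed_mat q [2] [2])"
      unfolding indexed_mat_append
      by (rule cong_four_block_mat) (auto simp: indexed_mat_def less_Suc_eq numeral_2_eq_2 q_def
          intro!: eq_matI)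
    also have "char_poly \<dots> = char_poly (indexed_mat q [0, 1] [0, 1]) * char_poly (indexed_mat q [2] [2])"
      by (rule char_poly_four_block_upper_right_zero) (auto simp: indexed_mat_def)
    also have "char_poly (indexed_mat q [2] [2]) = [:2 + 2 * of_nat r\<^sub>2, 1:]"
      unfolding char_poly_def char_poly_matrix_def by (subst det_single) (auto simp: indexed_mat_def)
    also have "char_poly (indexed_mat q [0, 1] [0, 1]) = F (of_nat r\<^sub>1)"
      by (subst char_poly_2) (auto simp: indexed_mat_def F_def)
    finally show ?thesis .
  qed

  \<comment> \<open>Roots of the quadratic factors\<close>
  have F: "F (complex_of_real x) =
      [:- complex_of_real ((x - 1) + sqrt ((x + 1)^2 + 4 * (x + real r\<^sub>1))), 1:] *
      [:- complex_of_real ((x - 1) - sqrt ((x + 1)^2 + 4 * (x + real r\<^sub>1))), 1:]"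
    if "- real r\<^sub>1 \<le> x" for x
  proof -
    define s where "s = sqrt ((x + 1)^2 + 4 * (x + real r\<^sub>1))"
    \<comment> \<open>The bound on \<open>x\<close> makes the radicand nonnegative, so the real
      square root really squares to it; sum and product of the roots then determine the
      quadratic.\<close>
    have "s ^ 2 = (x + 1)^2 + 4 * (x + real r\<^sub>1)"
      unfolding s_def using that by (intro real_sqrt_pow2) simp
    then have real_prod: "((x - 1) + s) * ((x - 1) - s) = - 4 * x - 4 * (x + real r\<^sub>1)"
      by (simp add: algebra_simps power2_eq_square)
    have "complex_of_real ((x - 1) + s) * complex_of_real ((x - 1) - s) =
        complex_of_real (- 4 * x - 4 * (x + real r\<^sub>1))"
      by (simp only: real_prod flip: of_real_mult)
    also have "\<dots> = - 4 * of_real x - 4 * (of_real x + of_nat r\<^sub>1)"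
      by simp
    finally have prod: "complex_of_real ((x - 1) + s) * complex_of_real ((x - 1) - s) =
        - 4 * of_real x - 4 * (of_real x + of_nat r\<^sub>1)" .
    have sum: "complex_of_real ((x - 1) + s) + complex_of_real ((x - 1) - s) = 2 * of_real x - 2"
      by simp
    have vieta: "[:- y, 1:] * [:- z, 1:] = [:y * z, - (y + z), 1:]" for y z :: complex
      by simp
    show ?thesis
      unfolding s_def[symmetric] vieta prod sum F_def by simp
  qed
  have lam: "- real r\<^sub>1 \<le> lam i" if "i \<in># mset_set {2..p\<^sub>1}" for i
    by (rule adjacency_eigenvalue_ge[OF G(1) reg(1) assms(11)]) (use that assms(14) in auto)
  have "F (of_nat r\<^sub>1) \<noteq> 0"
    by (simp add: F_def)

  \<comment> \<open>Cancelling \<open>char_poly Q\<close> and reading off the eigenvalues\<close>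
  have "char_poly (map_mat complex_of_real (eccentricity_matrix ?H vs)) * char_poly Q =
    (\<Prod>x\<in>#M\<^sub>1. F x) * ?L ^ (q\<^sub>1 - p\<^sub>1) * (\<Prod>x\<in>#M\<^sub>2. [:2 + 2 * x, 1:]) *
      char_poly (map_mat complex_of_real ?Q) * char_poly Q"
    unfolding main unfolding cN cN1 cN2 cQ by (simp only: mult_ac)
  then have "char_poly (map_mat complex_of_real (eccentricity_matrix ?H vs)) =
    (\<Prod>x\<in>#M\<^sub>1. F x) * ?L ^ (q\<^sub>1 - p\<^sub>1) * (\<Prod>x\<in>#M\<^sub>2. [:2 + 2 * x, 1:]) *
      char_poly (map_mat complex_of_real ?Q)"
    using \<open>F (of_nat r\<^sub>1) \<noteq> 0\<close> unfolding cQ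
    by (subst (asm) mult_right_cancel) (simp_all del: mult_pCons_right)
  also have "(\<Prod>x\<in>#M\<^sub>1. F x) * ?L ^ (q\<^sub>1 - p\<^sub>1) * (\<Prod>x\<in>#M\<^sub>2. [:2 + 2 * x, 1:]) =
    (\<Prod>x\<in>#image_mset complex_of_real ?M. [:- x, 1:])"
  proof -
    have "(\<Prod>x\<in>#M\<^sub>1. F x) = (\<Prod>i\<in>#mset_set {2..p\<^sub>1}. F (complex_of_real (lam i)))"
      unfolding M\<^sub>1_def by (simp add: multiset.map_comp comp_def)
    also have "\<dots> = (\<Prod>i\<in>#mset_set {2..p\<^sub>1}.
      [:- complex_of_real ((lam i - 1) + sqrt ((lam i + 1)^2 + 4 * (lam i + real r\<^sub>1))), 1:] *
      [:- complex_of_real ((lam i - 1) - sqrt ((lam i + 1)^2 + 4 * (lam i + real r\<^sub>1))), 1:])"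
      by (intro arg_cong[where f = prod_mset] image_mset_cong F lam)
    finally show ?thesis
      by (simp add: M\<^sub>2_def prod_mset.distrib multiset.map_comp comp_def mult_ac add.commute[of 2]
          del: mult_pCons_left mult_pCons_right)
  qed
  finally have factored: "char_poly (map_mat complex_of_real (eccentricity_matrix ?H vs)) =
    (\<Prod>x\<in>#image_mset complex_of_real ?M. [:- x, 1:]) * char_poly (map_mat complex_of_real ?Q)" .
  \<comment> \<open>Multisets of roots add up only over nonzero factors; this factor is
    monic.\<close>
  have nonzero: "char_poly (map_mat complex_of_real ?Q) \<noteq> 0"
    using degree_monic_char_poly[of "map_mat complex_of_real ?Q" 3]
    by (auto simp: mat_of_rows_list_def numeral_3_eq_3)
  show ?thesis
    unfolding eigenvalues_def factored proots_mult[OF prod_linear_nonzero nonzero] proots_prod_linear ..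
qed

end
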